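(* Let $X$ be a complex manifold equipped with a Hermitian metric $h$, and let $\varphi:\mathbb C\to X$ be an entire curve such that $$\lim_{r\to+\infty}a_\varphi(r)<+\infty,\qquad\text{where } a_\varphi(r)=\int_{\{|z|<r\}}\|\varphi'(z)\|_h^2\,d\mathrm{vol}(z).$$ Then $\varphi$ extends by continuity to a holomorphic map $\tilde\varphi:\mathbb P^1(\mathbb C)\to X$.
   Context: An entire curve is a holomorphic map $\varphi:\mathbb C\to X$, not necessarily injective. $d\mathrm{vol}$ is the standard area (Lebesgue) measure on $\mathbb C$; $a_\varphi(r)$ is the area with respect to $h$, counted with multiplicity, of the image under $\varphi$ of the disk of radius $r$ centred at $0$.
   Formalization: The image of φ is additionally assumed to lie in a compact subset of X (automatic for compact X, and necessary for the extension); without it the claim fails, e.g. X=ℂ, h=exp(-|z|²)|dz|², φ=id. X has pure positive dimension. *)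

theory Defs
  imports "HOL-Analysis.Analysis"
begin

text \<open>Holomorphic maps between complex coordinate spaces, to be used on open sets: the real
  Frechet derivative exists and is complex linear.\<close>

definition holomorphic_vec_on :: "(complex^'m::finite \<Rightarrow> complex^'n) \<Rightarrow> (complex^'m) set \<Rightarrow> bool" where
  "holomorphic_vec_on f S \<longleftrightarrow>
     (\<forall>x\<in>S. \<exists>D. (f has_derivative D) (at x) \<and> Vector_Spaces.linear (*s) (*s) D)"

text \<open>\<open>Ck_on k f S\<close>: \<open>f\<close> is of class \<open>C\<^sup>k\<close>, in the real sense, on the open set \<open>S\<close>.
  In finite dimension, \<open>C\<^sup>k\<^sup>+\<^sup>1\<close> means differentiable with all directional derivatives of
  class \<open>C\<^sup>k\<close>.\<close>

primrec Ck_on :: "nat \<Rightarrow> ('e::euclidean_space \<Rightarrow> 'f::real_normed_vector) \<Rightarrow> 'e set \<Rightarrow> bool" where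
  "Ck_on 0 f S \<longleftrightarrow> continuous_on S f"
| "Ck_on (Suc k) f S \<longleftrightarrow>
     (\<exists>f'. (\<forall>x\<in>S. (f has_derivative f' x) (at x)) \<and> (\<forall>v. Ck_on k (\<lambda>x. f' x v) S))"

definition smooth_on :: "('e::euclidean_space \<Rightarrow> 'f::real_normed_vector) \<Rightarrow> 'e set \<Rightarrow> bool" where
  "smooth_on f S \<longleftrightarrow> (\<forall>k. Ck_on k f S)"


section \<open>Complex manifolds and holomorphic maps\<close>

text \<open>A chart is a domain together with a coordinate map; the values of the coordinate map outside
  the domain are irrelevant.\<close>

type_synonym ('a, 'n) chart = "'a set \<times> ('a \<Rightarrow> complex^'n)"

definition is_chart :: "'a topology \<Rightarrow> ('a, 'n::finite) chart \<Rightarrow> bool" where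
  "is_chart X c \<longleftrightarrow> openin X (fst c) \<and> open (snd c ` fst c) \<and>
     homeomorphic_map (subtopology X (fst c)) (top_of_set (snd c ` fst c)) (snd c)"

definition chart_inv :: "('a, 'n::finite) chart \<Rightarrow> complex^'n \<Rightarrow> 'a" where
  "chart_inv c = inv_into (fst c) (snd c)"

definition transition :: "('a, 'n::finite) chart \<Rightarrow> ('a, 'n) chart \<Rightarrow> complex^'n \<Rightarrow> complex^'n" where
  "transition c d = snd d \<circ> chart_inv c"

definition complex_manifold :: "'a topology \<Rightarrow> ('a, 'n::finite) chart set \<Rightarrow> bool" where
  "complex_manifold X A \<longleftrightarrow>
     Hausdorff_space X \<and> second_countable X \<and>
     (\<forall>c\<in>A. is_chart X c) \<and> (\<Union>c\<in>A. fst c) = topspace X \<and>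
     (\<forall>c\<in>A. \<forall>d\<in>A. holomorphic_vec_on (transition c d) (snd c ` (fst c \<inter> fst d)))"

definition holomorphic_map ::
    "'a topology \<Rightarrow> ('a, 'm::finite) chart set \<Rightarrow> 'b topology \<Rightarrow> ('b, 'n::finite) chart set \<Rightarrow> ('a \<Rightarrow> 'b) \<Rightarrow> bool" where
  "holomorphic_map X A Y B f \<longleftrightarrow> continuous_map X Y f \<and>
     (\<forall>c\<in>A. \<forall>d\<in>B. holomorphic_vec_on (snd d \<circ> f \<circ> chart_inv c) (snd c ` {x \<in> fst c. f x \<in> fst d}))"

text \<open>The complex plane, with the topology \<open>euclidean\<close> and the identity chart.\<close>

definition plane_atlas :: "(complex, 1) chart set" where
  "plane_atlas = {(UNIV, vec)}"

text \<open>The Riemann sphere: \<open>Some z\<close> is the point \<open>[z : 1]\<close> and \<open>None\<close> is the point at infinity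
  \<open>[1 : 0]\<close>; the charts are \<open>z\<close> and \<open>1/z\<close>.\<close>

definition P1_topology :: "complex option topology" where
  "P1_topology = Alexandroff_compactification euclidean"

definition P1_atlas :: "(complex option, 1) chart set" where
  "P1_atlas =
     {(range Some, \<lambda>p. case p of None \<Rightarrow> 0 | Some z \<Rightarrow> vec z),
      (- {Some 0}, \<lambda>p. case p of None \<Rightarrow> 0 | Some z \<Rightarrow> vec (1 / z))}"

definition entire_curve :: "'a topology \<Rightarrow> ('a, 'n::finite) chart set \<Rightarrow> (complex \<Rightarrow> 'a) \<Rightarrow> bool" where
  "entire_curve X A \<phi> \<longleftrightarrow> holomorphic_map euclidean plane_atlas X A \<phi>"


section \<open>Hermitian metrics and area\<close>

definition sesq_form :: "complex^'n::finite^'n \<Rightarrow> complex^'n \<Rightarrow> complex^'n \<Rightarrow> complex" where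
  "sesq_form H v w = (\<Sum>i\<in>UNIV. \<Sum>j\<in>UNIV. H $ i $ j * v $ i * cnj (w $ j))"

text \<open>A Hermitian metric is given by its coefficient matrices: \<open>h c p\<close> is the matrix, in the frame
  of the holomorphic tangent space at \<open>p\<close> determined by the chart \<open>c\<close>.  The last condition is the
  transformation law which makes the inner product independent of the chart.\<close>

definition hermitian_metric ::
    "('a, 'n::finite) chart set \<Rightarrow> (('a, 'n) chart \<Rightarrow> 'a \<Rightarrow> complex^'n^'n) \<Rightarrow> bool" where
  "hermitian_metric A h \<longleftrightarrow>
     (\<forall>c\<in>A. \<forall>p\<in>fst c.
        (\<forall>i j. h c p $ j $ i = cnj (h c p $ i $ j)) \<and>
        (\<forall>v. v \<noteq> 0 \<longrightarrow> Re (sesq_form (h c p) v v) > 0)) \<and>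
     (\<forall>c\<in>A. \<forall>i j. smooth_on (\<lambda>x. h c (chart_inv c x) $ i $ j) (snd c ` fst c)) \<and>
     (\<forall>c\<in>A. \<forall>d\<in>A. \<forall>p\<in>fst c \<inter> fst d. \<forall>v w.
        sesq_form (h c p) v w =
          (let D = frechet_derivative (transition c d) (at (snd c p))
           in sesq_form (h d p) (D v) (D w)))"

text \<open>The chosen chart around \<open>p\<close> does not matter, by the transformation law.\<close>

definition chart_at :: "('a, 'n::finite) chart set \<Rightarrow> 'a \<Rightarrow> ('a, 'n) chart" where
  "chart_at A p = (SOME c. c \<in> A \<and> p \<in> fst c)"

definition curve_deriv :: "('a, 'n::finite) chart \<Rightarrow> (complex \<Rightarrow> 'a) \<Rightarrow> complex \<Rightarrow> complex^'n" where
  "curve_deriv c \<phi> z = (\<chi> i. deriv (\<lambda>w. snd c (\<phi> w) $ i) z)"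

definition speed ::
    "('a, 'n::finite) chart set \<Rightarrow> (('a, 'n) chart \<Rightarrow> 'a \<Rightarrow> complex^'n^'n) \<Rightarrow> (complex \<Rightarrow> 'a) \<Rightarrow> complex \<Rightarrow> real"
  where
  "speed A h \<phi> z =
     (let c = chart_at A (\<phi> z); v = curve_deriv c \<phi> z in sqrt (Re (sesq_form (h c (\<phi> z)) v v)))"

definition curve_area ::
    "('a, 'n::finite) chart set \<Rightarrow> (('a, 'n) chart \<Rightarrow> 'a \<Rightarrow> complex^'n^'n) \<Rightarrow> (complex \<Rightarrow> 'a) \<Rightarrow> real \<Rightarrow> real"
  where
  "curve_area A h \<phi> r = (LINT z:{z. norm z < r}|lborel. (speed A h \<phi> z)\<^sup>2)"

end

theory Submission
  imports Defs "HOL-Complex_Analysis.Cauchy_Integral_Formula"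
begin

text \<open>
  In a chart the metric is comparable to the Euclidean one and the components of \<open>\<phi>'\<close> are holomorphic, so
  the area mean value inequality bounds \<open>(r * \<parallel>\<phi>' z\<parallel>)\<^sup>2\<close> by the area of the image of the disc of radius \<open>r\<close> at
  \<open>z\<close>, as long as this disc is mapped into the chart.  A point-picking argument removes the last proviso when
  the area is small; as the area of the image of \<open>{w. \<parallel>z\<parallel> / 2 \<le> \<parallel>w\<parallel>}\<close> tends to \<open>0\<close>, so does
  \<open>\<parallel>z\<parallel> * \<parallel>\<phi>' z\<parallel>\<close>, and the circles \<open>\<parallel>z\<parallel> = r\<close> have images of length tending to \<open>0\<close>.  By compactness \<open>\<phi>\<close> has a
  cluster point \<open>p\<close> at infinity.  While \<open>\<phi>\<close> stays in a coordinate ball around \<open>p\<close>, the mean of its coordinates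
  over the circle of radius \<open>r\<close> is independent of \<open>r\<close> by Cauchy's theorem, which with the short circles prevents \<open>\<phi>\<close>
  from ever leaving the ball.  Hence \<open>\<phi>\<close> tends to \<open>p\<close>, and the singularity of \<open>w \<mapsto> \<phi> (1 / w)\<close> at \<open>0\<close> is removable.
\<close>

section \<open>Mean values of holomorphic functions\<close>

text \<open>Both measures agree on boxes. The identification gives access to the invariance of
  Lebesgue measure under orthogonal transformations, which is formulated on
  \<open>real^'n\<close>.\<close>

lemma lborel_complex_eq_distr_vec:
  "(lborel :: complex measure) = distr (lborel :: (real^2) measure) borel (\<lambda>v. Complex (v $ 1) (v $ 2))"
proof (rule lborel_eqI)
  let ?T = "\<lambda>v::real^2. Complex (v $ 1) (v $ 2)"
  have [measurable]: "?T \<in> borel_measurable borel"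
    by (intro borel_measurable_continuous_onI) (simp add: Complex_eq continuous_intros)
  fix l u :: complex assume le: "\<And>b. b \<in> Basis \<Longrightarrow> l \<bullet> b \<le> u \<bullet> b"
  have le': "Re l \<le> Re u" "Im l \<le> Im u"
    using le[of 1] le[of \<i>] by (auto simp: Basis_complex_def)
  let ?l = "(vector [Re l, Im l]) :: real^2" and ?u = "(vector [Re u, Im u]) :: real^2"
  have pre: "?T -` box l u = box ?l ?u"
    by (auto simp: box_def Basis_complex_def mem_box_cart forall_2 Basis_vec_def inner_axis)
  have lu: "?l $ i \<le> ?u $ i" for i
    using exhaust_2[of i] le' by auto
  have "emeasure lborel (box ?l ?u) = ennreal (\<Prod>b\<in>Basis. (?u - ?l) \<bullet> b)"
    by (rule emeasure_lborel_box) (auto simp: Basis_vec_def inner_axis intro!: lu)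
  also have "(\<Prod>b\<in>Basis. (?u - ?l) \<bullet> b) = (\<Prod>i\<in>(UNIV::2 set). (?u - ?l) $ i)"
    by (simp add: prod.UNION_disjoint Basis_vec_def axis_eq_axis inner_axis UNION_singleton_eq_range
        prod.reindex inj_on_def)
  also have "\<dots> = (\<Prod>b\<in>Basis. (u - l) \<bullet> b)"
    by (simp add: UNIV_2 Basis_complex_def)
  finally show "emeasure (distr lborel borel ?T) (box l u) = ennreal (\<Prod>b\<in>Basis. (u - l) \<bullet> b)"
    by (simp add: emeasure_distr pre)
qed simp

text \<open>Multiplication by a unit is a rotation, hence an orthogonal transformation of the plane;
  it suffices to compare the area of a box with that of its preimage.\<close>

lemma lborel_distr_mult_unit:
  fixes c :: complex
  assumes "norm c = 1"
  shows "distr lborel borel ((*) c) = lborel"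
proof (rule sym, rule lborel_eqI)
  let ?T = "\<lambda>v::real^2. Complex (v $ 1) (v $ 2)"
  let ?S = "\<lambda>z. (vector [Re z, Im z]) :: real^2"
  have [measurable]: "?T \<in> borel_measurable borel"
    by (intro borel_measurable_continuous_onI) (simp add: Complex_eq continuous_intros)
  have [measurable]: "(*) c \<in> borel_measurable borel"
    by simp
  have cc: "cnj c * c = 1" "c * cnj c = 1"
    using assms complex_norm_square[of c] by (auto simp: mult.commute)
  have ST: "?S (?T v) = v" for v
    by (simp add: vec_eq_iff forall_2)
  have TS: "?T (?S z) = z" for z
    by (simp add: complex_eq_iff)
  \<comment> \<open>The inverse rotation, written on \<open>real^2\<close>: the preimage of a box
    under multiplication by \<open>c\<close> is the image of the box under \<open>g\<close>.\<close>
  define g where "g v = ?S (cnj c * ?T v)" for v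
  have lin: "linear g"
    by (rule linearI) (auto simp: g_def vec_eq_iff forall_2 algebra_simps)
  have normT: "norm (?T v) = norm v" for v
    by (simp add: norm_vec_def L2_set_def UNIV_2 cmod_def)
  have normS: "norm (?S z) = norm z" for z
    by (simp add: norm_vec_def L2_set_def UNIV_2 cmod_def)
  have orth: "orthogonal_transformation g"
    unfolding orthogonal_transformation using lin
    unfolding g_def normS norm_mult normT by (simp add: assms)
  fix l u :: complex assume le: "\<And>b. b \<in> Basis \<Longrightarrow> l \<bullet> b \<le> u \<bullet> b"
  let ?B = "?T -` box l u"
  have "bounded ?B"
  proof -
    obtain K where "\<And>z. z \<in> box l u \<Longrightarrow> norm z \<le> K"
      using bounded_box[of l u] by (auto simp: bounded_iff)
    then have "\<And>v. v \<in> ?B \<Longrightarrow> norm v \<le> K"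
      using normT by (metis vimageE)
    then show ?thesis unfolding bounded_iff by blast
  qed
  moreover have op: "open ?B"
    by (intro open_vimage) (auto simp: Complex_eq intro!: continuous_intros)
  ultimately have lm: "?B \<in> lmeasurable"
    by (simp add: bounded_set_imp_lmeasurable borel_open)
  have img: "g ` ?B = ((*) c \<circ> ?T) -` box l u"
  proof safe
    have Tg: "?T (g v) = cnj c * ?T v" for v
      unfolding g_def by (rule TS)
    fix x assume "?T x \<in> box l u"
    then have "c * ?T (g x) \<in> box l u"
      unfolding Tg mult.assoc[symmetric] cc by simp
    then show "g x \<in> ((*) c \<circ> ?T) -` box l u" by simp
  next
    fix x assume x: "((*) c \<circ> ?T) x \<in> box l u"
    have "?T (?S (c * ?T x)) \<in> box l u"
      unfolding TS using x by simp
    moreover have "g (?S (c * ?T x)) = x"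
      unfolding g_def TS mult.assoc[symmetric] cc mult_1 by (rule ST)
    ultimately show "x \<in> g ` ?B"
      by (metis (mono_tags, lifting) imageI vimageI2)
  qed
  have op': "open (g ` ?B)"
    unfolding img by (intro open_vimage) (auto simp: Complex_eq o_def intro!: continuous_intros)
  have "emeasure (distr lborel borel ((*) c)) (box l u) = emeasure lborel (g ` ?B)"
    by (subst (1) lborel_complex_eq_distr_vec) (simp add: distr_distr emeasure_distr img)
  also have "\<dots> = emeasure lebesgue (g ` ?B)"
    using op' by simp
  also have "\<dots> = emeasure lebesgue ?B"
    using measurable_orthogonal_image[OF orth lm] measure_orthogonal_image[OF orth lm] lm
    by (simp add: emeasure_eq_measure2 fmeasurableD2)
  also have "\<dots> = emeasure lborel ?B"
    using op by simp
  also have "\<dots> = emeasure lborel (box l u)"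
    by (simp add: lborel_complex_eq_distr_vec emeasure_distr)
  also have "\<dots> = ennreal (\<Prod>b\<in>Basis. (u - l) \<bullet> b)"
    using le by simp
  finally show "emeasure (distr lborel borel ((*) c)) (box l u) = ennreal (\<Prod>b\<in>Basis. (u - l) \<bullet> b)" .
qed simp

text \<open>Cauchy's integral formula at \<open>0\<close> for \<open>z \<mapsto> w (z * y)\<close>.
  Working on the unit circle, with \<open>y\<close> inside the integrand, includes the degenerate
  circle \<open>y = 0\<close>.\<close>

lemma circle_mean_value:
  fixes w :: "complex \<Rightarrow> complex"
  assumes w: "w holomorphic_on cball 0 r" and y: "norm y \<le> r"
  shows "((\<lambda>t. w (cis (2 * pi * t) * y)) has_integral w 0) {0..1}"
proof -
  have "(\<lambda>z. w (z * y)) holomorphic_on cball 0 1"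
  proof (rule holomorphic_on_compose_gen[OF _ w, unfolded o_def])
    show "(\<lambda>z. z * y) ` cball 0 1 \<subseteq> cball 0 r"
    proof safe
      fix z :: complex assume "z \<in> cball 0 1"
      then have "norm z * norm y \<le> norm y"
        by (intro mult_left_le_one_le) auto
      then show "z * y \<in> cball 0 r"
        using y by (simp add: norm_mult)
    qed
  qed (intro holomorphic_intros)
  from Cauchy_integral_circlepath_simple[OF this, of 0]
  have "((\<lambda>u. w (u * y) / u) has_contour_integral 2 * pi * \<i> * w 0) (circlepath 0 1)"
    by simp
  then have "((\<lambda>x. w (exp (2 * pi * \<i> * of_real x) * y) / exp (2 * pi * \<i> * of_real x) *
      (2 * pi * \<i> * exp (2 * pi * \<i> * of_real x))) has_integral 2 * pi * \<i> * w 0) {0..1}"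
    unfolding has_contour_integral
    by (rule has_integral_eq[rotated])
       (subst vector_derivative_circlepath, auto simp: circlepath)
  then have "((\<lambda>x. 2 * pi * \<i> * w (cis (2 * pi * x) * y)) has_integral 2 * pi * \<i> * w 0) {0..1}"
    by (rule has_integral_eq[rotated]) (simp add: cis_conv_exp mult_ac)
  from has_integral_mult_right[OF this, of "1 / (2 * pi * \<i>)"] show ?thesis
    by simp
qed

text \<open>Rotations preserve the integral over the disc, so \<open>w y\<close> may be replaced by
  its average over all rotations of \<open>y\<close>. By Fubini the averaging can be done first, and
  the mean value property on circles turns it into \<open>w 0\<close>. This takes the place of polar
  coordinates.\<close>

lemma integral_cball_holomorphic:
  fixes w :: "complex \<Rightarrow> complex"
  assumes w: "w holomorphic_on cball 0 r"
  shows "(LINT y:cball 0 r|lborel. w y) = measure lborel (cball (0::complex) r) *\<^sub>R w 0"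
proof -
  define W where "W y = indicator (cball 0 r) y *\<^sub>R w y" for y
  have contw: "continuous_on (cball 0 r) w"
    using w by (rule holomorphic_on_imp_continuous_on)
  have intW: "integrable lborel W"
    unfolding W_def using contw by (intro borel_integrable_compact) auto
  have rot: "(\<integral>y. W (cis t * y) \<partial>lborel) = integral\<^sup>L lborel W" for t
    by (subst lborel_distr_mult_unit[symmetric, of "cis t"], simp, subst integral_distr)
       (use borel_measurable_integrable[OF intW] in simp_all)
  \<comment> \<open>The integrand over all rotations \<open>t\<close> and all points
    \<open>y\<close>; being continuous on a compact set it is integrable, as Fubini
    requires.\<close>
  define G where "G = (\<lambda>(t, y). indicator ({0..1} \<times> cball 0 r) (t, y) *\<^sub>R w (cis (2 * pi * t) * y))"
  have "integrable lborel G"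
    unfolding G_def case_prod_beta prod.collapse
    by (intro borel_integrable_compact compact_Times continuous_on_compose2[OF contw] continuous_intros)
       (auto simp: norm_mult)
  then have intG: "integrable (lborel \<Otimes>\<^sub>M lborel) (\<lambda>(t, y). G (t, y))"
    by (simp add: lborel_prod)
  have G_eq: "G (t, y) = indicator {0..1} t *\<^sub>R W (cis (2 * pi * t) * y)" for t y
    by (auto simp: G_def W_def indicator_def norm_mult)
  have inner1: "(\<integral>y. G (t, y) \<partial>lborel) = indicator {0..1} t *\<^sub>R integral\<^sup>L lborel W" for t
    unfolding G_eq by (simp add: rot)
  have inner2: "(\<integral>t. G (t, y) \<partial>lborel) = indicator (cball 0 r) y *\<^sub>R w 0" for y
  proof (cases "norm y \<le> r")
    case True
    have "G (t, y) = indicator {0..1} t *\<^sub>R w (cis (2 * pi * t) * y)" for t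
      using True by (auto simp: G_def indicator_def)
    moreover have "(LINT t:{0..1}|lborel. w (cis (2 * pi * t) * y)) = integral {0..1} (\<lambda>t. w (cis (2 * pi * t) * y))"
      unfolding set_lebesgue_integral_def[symmetric]
      by (rule set_borel_integral_eq_integral, unfold set_integrable_def)
         (use True in \<open>auto intro!: borel_integrable_compact continuous_on_compose2[OF contw] continuous_intros simp: norm_mult\<close>)
    ultimately show ?thesis
      using integral_unique[OF circle_mean_value[OF w True]] True
      by (simp add: set_lebesgue_integral_def)
  qed (auto simp: G_def indicator_def)
  have "(\<integral>y. \<integral>t. G (t, y) \<partial>lborel \<partial>lborel) = (\<integral>t. \<integral>y. G (t, y) \<partial>lborel \<partial>lborel)"
    by (rule lborel_pair.Fubini_integral[OF intG])
  moreover have "(\<integral>y. indicator (cball 0 r) (y::complex) *\<^sub>R w 0 \<partial>lborel) = measure lborel (cball (0::complex) r) *\<^sub>R w 0"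
    by (subst Bochner_Integration.integral_scaleR_left)
       (auto simp: integrable_indicator_iff emeasure_bounded_finite[unfolded infinity_ennreal_def])
  ultimately show ?thesis
    by (simp add: inner1 inner2 set_lebesgue_integral_def W_def[abs_def])
qed

text \<open>Subharmonicity of the squared modulus: the mean value property of the holomorphic
  function \<open>f\<^sup>2\<close>, followed by the triangle inequality for integrals.\<close>

lemma cmod_square_le_area_integral:
  fixes f :: "complex \<Rightarrow> complex"
  assumes f: "f holomorphic_on cball z r" and r: "0 \<le> r"
  shows "(cmod (f z))\<^sup>2 * measure lborel (cball z r) \<le> (LINT w:cball z r|lborel. (cmod (f w))\<^sup>2)"
proof -
  define w where "w y = (f (z + y))\<^sup>2" for y
  have sub: "(\<lambda>y. z + y) ` cball 0 r \<subseteq> cball z r"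
    by (auto simp: dist_norm)
  have w: "w holomorphic_on cball 0 r"
    unfolding w_def by (intro holomorphic_on_power holomorphic_on_compose_gen[OF _ f sub, unfolded o_def] holomorphic_intros)
  have integ: "integrable lborel (\<lambda>w. indicator (cball z r) w *\<^sub>R (cmod (f w))\<^sup>2)"
    by (intro borel_integrable_compact continuous_intros holomorphic_on_imp_continuous_on[OF f]) auto
  have "(cmod (f z))\<^sup>2 * measure lborel (cball z r) = norm (LINT y:cball 0 r|lborel. w y)"
    unfolding integral_cball_holomorphic[OF w]
    by (simp add: w_def norm_power mult.commute content_cball r)
  also have "\<dots> \<le> (LINT y:cball 0 r|lborel. norm (w y))"
    unfolding set_lebesgue_integral_def
    by (rule order_trans[OF integral_norm_bound]) simp
  also have "\<dots> = (\<integral>y. indicator (cball z r) (z + y) *\<^sub>R (cmod (f (z + y)))\<^sup>2 \<partial>lborel)"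
    unfolding set_lebesgue_integral_def
    by (rule Bochner_Integration.integral_cong) (auto simp: w_def norm_power indicator_def dist_norm)
  also have "\<dots> = (LINT w:cball z r|lborel. (cmod (f w))\<^sup>2)"
    unfolding set_lebesgue_integral_def
    by (subst (2) lborel_distr_plus[symmetric, of z], subst integral_distr)
       (use borel_measurable_integrable[OF integ] in simp_all)
  finally show ?thesis .
qed

text \<open>Up to the factor \<open>2 * pi * \<i>\<close>, the mean of \<open>f\<close> over a
  circle around \<open>0\<close> is the contour integral of \<open>f z / z\<close>, and Cauchy's
  theorem on the annulus makes it independent of the radius. It differs from \<open>f x\<close> and
  from \<open>f y\<close> by at most \<open>d\<close>.\<close>

lemma circle_oscillation_bound:
  fixes f :: "complex \<Rightarrow> complex"
  assumes S: "open S" and f: "f holomorphic_on S"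
    and r: "0 < r" "r \<le> R" and sub: "{z. r \<le> norm z \<and> norm z \<le> R} \<subseteq> S"
    and osc: "\<And>z. norm z = r \<Longrightarrow> norm (f z - f x) \<le> d" "\<And>z. norm z = R \<Longrightarrow> norm (f z - f y) \<le> d"
  shows "norm (f x - f y) \<le> 2 * d"
proof -
  have d: "0 \<le> d"
    by (rule order_trans[OF norm_ge_zero osc(1)[of "of_real r"]]) (use r in simp)
  have dev: "norm (contour_integral (circlepath 0 s) (\<lambda>z. f z / z) - 2 * pi * \<i> * f a) \<le> 2 * pi * d"
    if s: "0 < s" "{z. norm z = s} \<subseteq> S" and a: "\<And>z. norm z = s \<Longrightarrow> norm (f z - f a) \<le> d" for s a
  proof -
    have "sphere 0 s \<subseteq> S"
      using s(2) by auto
    then have "continuous_on (sphere 0 s) f"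
      using f holomorphic_on_imp_continuous_on holomorphic_on_subset by blast
    then have "(\<lambda>z. f z / z) contour_integrable_on circlepath 0 s"
      using s(1) by (intro contour_integrable_continuous_circlepath continuous_intros) auto
    then have 1: "((\<lambda>z. f z / z) has_contour_integral contour_integral (circlepath 0 s) (\<lambda>z. f z / z)) (circlepath 0 s)"
      by (rule has_contour_integral_integral)
    have 2: "((\<lambda>z. f a / z) has_contour_integral 2 * pi * \<i> * f a) (circlepath 0 s)"
      using Cauchy_integral_circlepath_simple[of "\<lambda>_. f a" 0 s 0] s(1) by simp
    have "norm (contour_integral (circlepath 0 s) (\<lambda>z. f z / z) - 2 * pi * \<i> * f a) \<le> d / s * (2 * pi * s)"
    proof (rule has_contour_integral_bound_circlepath[OF has_contour_integral_diff[OF 1 2]])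
      fix z :: complex assume "norm (z - 0) = s"
      then show "norm (f z / z - f a / z) \<le> d / s"
        using a[of z] s(1) by (simp add: diff_divide_distrib[symmetric] norm_divide divide_right_mono)
    qed (use s d in auto)
    then show ?thesis using s(1) by (simp add: mult_ac)
  qed
  \<comment> \<open>The radial homotopy between the circles stays in the annulus; \<open>0\<close>
    is taken out because \<open>f z / z\<close> need not be holomorphic there.\<close>
  have hom: "homotopic_loops (S - {0}) (circlepath 0 r) (circlepath 0 R)"
  proof (rule homotopic_loops_linear)
    fix t :: real
    have [simp]: "norm (exp (2 * of_real pi * \<i> * of_real t)) = 1"
      using norm_exp_i_times[of "2 * pi * t"] by (simp add: mult_ac)
    show "closed_segment (circlepath 0 r t) (circlepath 0 R t) \<subseteq> S - {0}"
    proof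
      fix z assume "z \<in> closed_segment (circlepath 0 r t) (circlepath 0 R t)"
      then obtain u where u: "0 \<le> u" "u \<le> 1" "z = (1 - u) *\<^sub>R circlepath 0 r t + u *\<^sub>R circlepath 0 R t"
        unfolding closed_segment_def by blast
      define q where "q = (1 - u) * r + u * R"
      have "z = of_real q * exp (2 * of_real pi * \<i> * of_real t)"
        unfolding u circlepath q_def by (simp add: scaleR_conv_of_real algebra_simps)
      moreover have "r \<le> q" "q \<le> R"
        unfolding q_def using r u convex_bound_le[of r R R "1 - u" u] mult_left_mono[of r R u]
        by (simp_all add: left_diff_distrib)
      ultimately have "norm z = q" "0 < q" "r \<le> norm z" "norm z \<le> R"
        using r by (auto simp: norm_mult)
      then show "z \<in> S - {0}"
        using sub by auto
    qed
  qed auto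
  have "contour_integral (circlepath 0 r) (\<lambda>z. f z / z) = contour_integral (circlepath 0 R) (\<lambda>z. f z / z)"
    by (rule Cauchy_theorem_homotopic_loops[OF hom])
       (auto intro!: holomorphic_intros holomorphic_on_subset[OF f] S)
  moreover have "norm (contour_integral (circlepath 0 r) (\<lambda>z. f z / z) - 2 * pi * \<i> * f x) \<le> 2 * pi * d"
    using r sub osc by (intro dev) auto
  moreover have "norm (contour_integral (circlepath 0 R) (\<lambda>z. f z / z) - 2 * pi * \<i> * f y) \<le> 2 * pi * d"
    using r sub osc by (intro dev) auto
  ultimately have "norm (2 * pi * \<i> * f x - 2 * pi * \<i> * f y) \<le> 2 * pi * d + 2 * pi * d"
    using norm_diff_triangle_le[of "2 * pi * \<i> * f x" "contour_integral (circlepath 0 R) (\<lambda>z. f z / z)" "2 * pi * d"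
        "2 * pi * \<i> * f y" "2 * pi * d"] by (simp add: norm_minus_commute)
  then have "2 * pi * norm (f x - f y) \<le> 2 * pi * (2 * d)"
    by (simp add: right_diff_distrib[symmetric] norm_mult)
  then show ?thesis by simp
qed

section \<open>Vector-valued maps and charts\<close>

lemma has_derivative_vecI:
  fixes f :: "'a::real_normed_vector \<Rightarrow> complex^'n"
  assumes "\<And>i. ((\<lambda>x. f x $ i) has_derivative (\<lambda>k. D k $ i)) F"
  shows "(f has_derivative D) F"
proof -
  have ax: "bounded_linear (axis i :: complex \<Rightarrow> complex^'n)" for i
    by (rule linear_conv_bounded_linear[THEN iffD1]) (auto intro!: linearI simp: vec_eq_iff axis_def)
  have rep: "(\<Sum>i\<in>UNIV. axis i (v $ i)) = v" for v :: "complex^'n"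
    by (simp add: vec_eq_iff axis_def sum.delta)
  have "((\<lambda>x. \<Sum>i\<in>UNIV. axis i (f x $ i)) has_derivative (\<lambda>k. \<Sum>i\<in>UNIV. axis i (D k $ i))) F"
    by (intro has_derivative_sum bounded_linear.has_derivative[OF ax] assms)
  then show ?thesis by (simp only: rep)
qed

lemma has_derivative_complex_curve:
  fixes F :: "complex \<Rightarrow> complex^'n"
  assumes "\<And>j. (\<lambda>w. F w $ j) field_differentiable at z"
  shows "(F has_derivative (\<lambda>k. k *s (\<chi> j. deriv (\<lambda>w. F w $ j) z))) (at z)"
proof (rule has_derivative_vecI)
  fix i
  have "((\<lambda>w. F w $ i) has_field_derivative deriv (\<lambda>w. F w $ i) z) (at z)"
    using assms by (simp add: field_differentiable_derivI)
  then show "((\<lambda>w. F w $ i) has_derivative (\<lambda>k. (k *s (\<chi> j. deriv (\<lambda>w. F w $ j) z)) $ i)) (at z)"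
    by (rule has_derivative_eq_rhs[OF has_field_derivative_imp_has_derivative]) (simp add: fun_eq_iff)
qed

text \<open>Connects holomorphy on \<open>complex^1\<close>, as used for manifolds, with
  one-variable complex analysis. A complex-linear map \<open>D\<close> out of
  \<open>complex^1\<close> is multiplication by the vector \<open>D (vec 1)\<close>, whose
  components are the complex derivatives.\<close>

lemma holomorphic_vec_on_curve_iff:
  fixes F :: "complex \<Rightarrow> complex^'n"
  assumes S: "open S"
  shows "holomorphic_vec_on (\<lambda>x::complex^1. F (x $ 1)) (vec ` S) \<longleftrightarrow> (\<forall>j. (\<lambda>z. F z $ j) holomorphic_on S)"
proof
  assume L: "holomorphic_vec_on (\<lambda>x::complex^1. F (x $ 1)) (vec ` S)"
  show "\<forall>j. (\<lambda>z. F z $ j) holomorphic_on S"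
  proof (intro allI holomorphic_onI)
    fix j z assume "z \<in> S"
    then obtain D where D: "((\<lambda>x::complex^1. F (x $ 1)) has_derivative D) (at (vec z))"
      and lin: "Vector_Spaces.linear (*s) (*s) D"
      using L unfolding holomorphic_vec_on_def by auto
    have "((vec :: complex \<Rightarrow> complex^1) has_derivative vec) (at z)"
      by (rule has_derivative_vecI) simp
    from diff_chain_at[OF this D]
    have "((\<lambda>z. F z) has_derivative (\<lambda>k. D (vec k))) (at z)"
      by (simp add: o_def)
    from bounded_linear.has_derivative[OF bounded_linear_vec_nth this]
    have der: "((\<lambda>z. F z $ j) has_derivative (\<lambda>k. D (vec k) $ j)) (at z)" .
    have "D (vec k) = k *s D (vec 1)" for k
    proof -
      have "vec k = k *s (vec 1 :: complex^1)"
        by (simp add: vec_eq_iff)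
      then show ?thesis
        using lin unfolding Vector_Spaces.linear_def module_hom_def module_hom_axioms_def by metis
    qed
    then have "(\<lambda>k. D (vec k) $ j) = (*) (D (vec 1) $ j)"
      by (simp add: fun_eq_iff mult.commute)
    with der show "(\<lambda>z. F z $ j) field_differentiable at z within S"
      by (metis has_field_derivative_def field_differentiable_def field_differentiable_at_within)
  qed
next
  assume R: "\<forall>j. (\<lambda>z. F z $ j) holomorphic_on S"
  show "holomorphic_vec_on (\<lambda>x::complex^1. F (x $ 1)) (vec ` S)"
    unfolding holomorphic_vec_on_def
  proof safe
    fix z assume z: "z \<in> S"
    let ?v = "\<chi> j. deriv (\<lambda>w. F w $ j) z"
    have "(F has_derivative (\<lambda>k. k *s ?v)) (at z)"
      using R z S by (intro has_derivative_complex_curve) (simp add: holomorphic_on_open field_differentiable_def)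
    moreover have "((\<lambda>x::complex^1. x $ 1) has_derivative (\<lambda>x. x $ 1)) (at (vec z))"
      by (rule bounded_linear_imp_has_derivative[OF bounded_linear_vec_nth])
    ultimately have "((\<lambda>x::complex^1. F (x $ 1)) has_derivative (\<lambda>x. x $ 1 *s ?v)) (at (vec z))"
      using diff_chain_at[of "\<lambda>x::complex^1. x $ 1" _ "vec z" F] by (fastforce simp: o_def)
    moreover have "Vector_Spaces.linear (*s) (*s) (\<lambda>x::complex^1. x $ 1 *s ?v)"
      by unfold_locales (auto simp: vec_eq_iff algebra_simps)
    ultimately show "\<exists>D. ((\<lambda>x::complex^1. F (x $ 1)) has_derivative D) (at (vec z)) \<and> Vector_Spaces.linear (*s) (*s) D"
      by blast
  qed
qed

lemma norm_vector_scalar_mult: "norm (a *s v) = norm a * norm v" for a :: complex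
  by (simp add: norm_vec_def L2_set_right_distrib norm_mult)

lemma set_integrable_continuous_compact:
  fixes f :: "'e::euclidean_space \<Rightarrow> real"
  assumes "compact S" "continuous_on S f"
  shows "set_integrable lborel S f"
  using borel_integrable_compact[OF assms] by (simp add: set_integrable_def)

lemma norm_vec_le_card_mult:
  fixes v :: "complex^'n"
  assumes "\<And>i. norm (v $ i) \<le> B"
  shows "norm v \<le> real CARD('n) * B"
proof -
  have "norm v \<le> (\<Sum>i\<in>UNIV. norm (v $ i))"
    unfolding norm_vec_def by (rule L2_set_le_sum) simp
  also have "\<dots> \<le> (\<Sum>i\<in>(UNIV :: 'n set). B)"
    by (rule sum_mono) (rule assms)
  finally show ?thesis by simp
qed

section \<open>Topology of charts\<close>

lemma is_chartD:
  assumes "is_chart X c"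
  shows "openin X (fst c)" "open (snd c ` fst c)" "inj_on (snd c) (fst c)"
    "continuous_map (subtopology X (fst c)) euclidean (snd c)"
    "continuous_map (top_of_set (snd c ` fst c)) X (chart_inv c)"
proof -
  show op: "openin X (fst c)" and "open (snd c ` fst c)"
    using assms by (auto simp: is_chart_def)
  have top: "topspace (subtopology X (fst c)) = fst c"
    using openin_subset[OF op] by auto
  have hm: "homeomorphic_map (subtopology X (fst c)) (top_of_set (snd c ` fst c)) (snd c)"
    using assms by (simp add: is_chart_def)
  then show inj: "inj_on (snd c) (fst c)"
    using homeomorphic_imp_injective_map top by metis
  show "continuous_map (subtopology X (fst c)) euclidean (snd c)"
    using homeomorphic_imp_continuous_map[OF hm] continuous_map_in_subtopology by blast
  have "homeomorphic_maps (subtopology X (fst c)) (top_of_set (snd c ` fst c)) (snd c) (chart_inv c)"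
  proof -
    \<comment> \<open>The homeomorphism comes with some inverse \<open>g\<close>; injectivity
      identifies it with \<open>chart_inv\<close> on the coordinate domain, so
      \<open>chart_inv\<close> inherits its continuity.\<close>
    obtain g where g: "homeomorphic_maps (subtopology X (fst c)) (top_of_set (snd c ` fst c)) (snd c) g"
      using hm homeomorphic_map_maps by blast
    have "g x = chart_inv c x" if "x \<in> snd c ` fst c" for x
      using g that top inj unfolding homeomorphic_maps_def chart_inv_def
      by (auto simp: inv_into_f_f)
    then show ?thesis
      by (intro homeomorphic_maps_eq[OF g]) auto
  qed
  then show "continuous_map (top_of_set (snd c ` fst c)) X (chart_inv c)"
    unfolding homeomorphic_maps_def continuous_map_in_subtopology by blast
qed

lemma chart_inv_coord: "is_chart X c \<Longrightarrow> q \<in> fst c \<Longrightarrow> chart_inv c (snd c q) = q"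
  unfolding chart_inv_def by (rule inv_into_f_f[OF is_chartD(3)])

lemma openin_coord_ball:
  assumes "is_chart X c"
  shows "openin X {q \<in> fst c. snd c q \<in> ball x t}"
proof -
  have "openin (subtopology X (fst c)) {q \<in> topspace (subtopology X (fst c)). snd c q \<in> ball x t}"
    by (rule openin_continuous_map_preimage[OF is_chartD(4)[OF assms]]) simp
  then show ?thesis
    using is_chartD(1)[OF assms] openin_subset[OF is_chartD(1)[OF assms]]
    by (simp add: openin_open_subtopology Int_absorb1 Collect_conj_eq inf_absorb2)
qed

text \<open>The image of a closed ball under \<open>chart_inv\<close> is compact, and compact sets
  in a Hausdorff space are closed. Closedness in all of \<open>X\<close>, not just in the chart
  domain, stops limits of points of the ball from leaving the chart.\<close>

lemma closedin_coord_cball: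
  assumes "Hausdorff_space X" "is_chart X c" "cball x t \<subseteq> snd c ` fst c"
  shows "closedin X {q \<in> fst c. snd c q \<in> cball x t}"
proof -
  have "compactin X (chart_inv c ` cball x t)"
    by (rule image_compactin[OF _ is_chartD(5)[OF assms(2)]])
       (use assms(3) in \<open>auto simp: compactin_subtopology\<close>)
  moreover have "chart_inv c ` cball x t = {q \<in> fst c. snd c q \<in> cball x t}"
  proof safe
    fix y assume "y \<in> cball x t"
    with assms(3) obtain q where "q \<in> fst c" "y = snd c q"
      by blast
    then show "chart_inv c y \<in> fst c" "snd c (chart_inv c y) \<in> cball x t"
      using chart_inv_coord[OF assms(2)] \<open>y \<in> cball x t\<close> by auto
  next
    fix q assume "q \<in> fst c" "snd c q \<in> cball x t"
    then show "q \<in> chart_inv c ` cball x t"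
      using chart_inv_coord[OF assms(2)] by (metis imageI)
  qed
  ultimately show ?thesis
    using assms(1) by (simp add: compactin_imp_closedin)
qed

lemma sesq_form_scaleR: "sesq_form H (a *\<^sub>R v) (a *\<^sub>R v) = (a\<^sup>2) *\<^sub>R sesq_form H v v"
  by (simp add: sesq_form_def sum_distrib_left power2_eq_square scaleR_conv_of_real[where 'a=complex] mult_ac)

text \<open>The inverse of the chart at infinity, \<open>w \<mapsto> [1 : w]\<close> in homogeneous
  coordinates.\<close>

definition P1_coord_inv :: "complex \<Rightarrow> complex option" where
  "P1_coord_inv w = (if w = 0 then None else Some (1 / w))"

lemma chart_inv_P1_finite:
  "chart_inv (range Some, \<lambda>p. case p of None \<Rightarrow> 0 | Some z \<Rightarrow> vec z) = (\<lambda>x::complex^1. Some (x $ 1))"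
proof
  fix x :: "complex^1"
  show "chart_inv (range Some, \<lambda>p. case p of None \<Rightarrow> 0 | Some z \<Rightarrow> vec z) x = Some (x $ 1)"
    unfolding chart_inv_def fst_conv snd_conv
    by (rule inv_into_f_eq) (auto simp: inj_on_def vec_eq_iff)
qed

lemma chart_inv_P1_infinity:
  "chart_inv (- {Some 0}, \<lambda>p. case p of None \<Rightarrow> 0 | Some z \<Rightarrow> vec (1 / z)) = (\<lambda>x::complex^1. P1_coord_inv (x $ 1))"
proof
  fix x :: "complex^1"
  show "chart_inv (- {Some 0}, \<lambda>p. case p of None \<Rightarrow> 0 | Some z \<Rightarrow> vec (1 / z)) x = P1_coord_inv (x $ 1)"
    unfolding chart_inv_def fst_conv snd_conv
    by (rule inv_into_f_eq) (auto simp: inj_on_def vec_eq_iff P1_coord_inv_def split: option.splits)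
qed

text \<open>Gives the domain of a coordinate expression near infinity the shape that
  \<open>holomorphic_vec_on_curve_iff\<close> asks for; the point \<open>None\<close> corresponds to
  \<open>w = 0\<close>.\<close>

lemma P1_coord_infinity_image:
  "(\<lambda>p. case p of None \<Rightarrow> 0 | Some z \<Rightarrow> vec (1 / z)) ` {x \<in> - {Some 0}. x \<in> B} = (vec ` {w. P1_coord_inv w \<in> B} :: (complex^1) set)"
    (is "?f ` ?B = _")
proof (intro equalityI subsetI)
  fix y assume "y \<in> ?f ` ?B"
  then obtain q where q: "q \<in> ?B" "y = ?f q" by blast
  show "y \<in> vec ` {w. P1_coord_inv w \<in> B}"
  proof (cases q)
    case None
    then show ?thesis
      using q by (intro image_eqI[of _ _ 0]) (auto simp: P1_coord_inv_def vec_eq_iff)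
  next
    case (Some z)
    then show ?thesis
      using q by (intro image_eqI[of _ _ "1 / z"]) (auto simp: P1_coord_inv_def)
  qed
next
  fix y :: "complex^1" assume "y \<in> vec ` {w. P1_coord_inv w \<in> B}"
  then obtain w where "P1_coord_inv w \<in> B" "y = vec w" by blast
  then show "y \<in> ?f ` ?B"
    by (intro image_eqI[of _ _ "P1_coord_inv w"]) (auto simp: P1_coord_inv_def vec_eq_iff)
qed

section \<open>The speed of an entire curve\<close>

locale hermitian_entire_curve =
  fixes X :: "'a topology"
    and A :: "('a, 'n::finite) chart set"
    and h :: "('a, 'n) chart \<Rightarrow> 'a \<Rightarrow> complex^'n^'n"
    and \<phi> :: "complex \<Rightarrow> 'a"
  assumes manifold: "complex_manifold X A"
    and metric: "hermitian_metric A h"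
    and curve: "entire_curve X A \<phi>"
begin

section \<open>The curve and its speed in local coordinates\<close>

lemma chart: "c \<in> A \<Longrightarrow> is_chart X c"
  using manifold by (simp add: complex_manifold_def)

lemma continuous_curve: "continuous_map euclidean X \<phi>"
  using curve by (simp add: entire_curve_def holomorphic_map_def)

lemma curve_in_space: "\<phi> z \<in> topspace X"
  using continuous_map_image_subset_topspace[OF continuous_curve] by auto

lemma open_curve_preimage: "openin X U \<Longrightarrow> open {z. \<phi> z \<in> U}"
  using openin_continuous_map_preimage[OF continuous_curve] by force

lemma closed_curve_preimage: "closedin X U \<Longrightarrow> closed {z. \<phi> z \<in> U}"
  using closedin_continuous_map_preimage[OF continuous_curve] by force

lemma open_chart_preimage: "c \<in> A \<Longrightarrow> open {z. \<phi> z \<in> fst c}"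
  using open_curve_preimage is_chartD(1)[OF chart] by blast

lemma chart_exists: "p \<in> topspace X \<Longrightarrow> \<exists>c\<in>A. p \<in> fst c"
  using manifold by (auto simp: complex_manifold_def)

lemma coord_holomorphic:
  assumes "c \<in> A"
  shows "(\<lambda>z. snd c (\<phi> z) $ j) holomorphic_on {z. \<phi> z \<in> fst c}"
proof -
  have inv: "chart_inv (UNIV, vec) = (\<lambda>x::complex^1. x $ 1)"
  proof
    fix x :: "complex^1"
    have "inj (vec :: complex \<Rightarrow> complex^1)"
      by (simp add: inj_on_def vec_eq_iff)
    then have "inv vec (vec (x $ 1) :: complex^1) = x $ 1"
      by (rule inv_f_f)
    moreover have "vec (x $ 1) = x"
      by (simp add: vec_eq_iff)
    ultimately show "chart_inv (UNIV, vec) x = x $ 1"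
      by (simp add: chart_inv_def)
  qed
  have "holomorphic_vec_on (\<lambda>x::complex^1. snd c (\<phi> (x $ 1))) (vec ` {z. \<phi> z \<in> fst c})"
    using curve assms unfolding entire_curve_def holomorphic_map_def plane_atlas_def
    by (simp add: inv o_def)
  moreover have "holomorphic_vec_on (\<lambda>x::complex^1. snd c (\<phi> (x $ 1))) (vec ` {z. \<phi> z \<in> fst c}) \<longleftrightarrow>
      (\<forall>j. (\<lambda>z. snd c (\<phi> z) $ j) holomorphic_on {z. \<phi> z \<in> fst c})"
    by (rule holomorphic_vec_on_curve_iff[where F = "\<lambda>z. snd c (\<phi> z)", OF open_chart_preimage[OF assms]])
  ultimately show ?thesis
    by (rule iffD1[THEN spec, rotated])
qed

lemma coord_has_derivative:
  assumes "c \<in> A" "\<phi> z \<in> fst c"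
  shows "((\<lambda>w. snd c (\<phi> w)) has_derivative (\<lambda>k. k *s curve_deriv c \<phi> z)) (at z)"
proof -
  have "(\<lambda>w. snd c (\<phi> w) $ j) field_differentiable at z" for j
    using coord_holomorphic[OF assms(1), of j] open_chart_preimage[OF assms(1)] assms(2)
    by (metis holomorphic_on_imp_differentiable_at mem_Collect_eq)
  then show ?thesis
    unfolding curve_deriv_def using has_derivative_complex_curve[of "\<lambda>w. snd c (\<phi> w)" z] by simp
qed

lemma coord_continuous:
  assumes "c \<in> A"
  shows "continuous_on {z. \<phi> z \<in> fst c} (\<lambda>w. snd c (\<phi> w))"
  by (rule has_derivative_continuous_on, rule has_derivative_at_withinI, rule coord_has_derivative[OF assms]) simp

lemma chart_at: "chart_at A (\<phi> z) \<in> A" "\<phi> z \<in> fst (chart_at A (\<phi> z))"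
proof -
  have "\<exists>c. c \<in> A \<and> \<phi> z \<in> fst c"
    using chart_exists[OF curve_in_space] by blast
  from someI_ex[OF this] show "chart_at A (\<phi> z) \<in> A" "\<phi> z \<in> fst (chart_at A (\<phi> z))"
    unfolding chart_at_def by auto
qed

text \<open>Independence of the chart: by the chain rule the derivative of the transition map
  carries the velocity in \<open>c\<close> to the velocity in the chart chosen by
  \<open>speed\<close>, and the transformation law of the metric absorbs this derivative.\<close>

lemma speed_sq:
  assumes c: "c \<in> A" and z: "\<phi> z \<in> fst c"
  shows "(speed A h \<phi> z)\<^sup>2 = Re (sesq_form (h c (\<phi> z)) (curve_deriv c \<phi> z) (curve_deriv c \<phi> z))"
proof -
  define d where "d = chart_at A (\<phi> z)"
  have d: "d \<in> A" "\<phi> z \<in> fst d"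
    unfolding d_def by (rule chart_at)+
  define D where "D = frechet_derivative (transition c d) (at (snd c (\<phi> z)))"
  have "holomorphic_vec_on (transition c d) (snd c ` (fst c \<inter> fst d))"
    using manifold c d(1) by (simp add: complex_manifold_def)
  then have "transition c d differentiable at (snd c (\<phi> z))"
    using z d unfolding holomorphic_vec_on_def differentiable_def by blast
  then have "(transition c d has_derivative D) (at (snd c (\<phi> z)))"
    unfolding D_def using frechet_derivative_works by blast
  from diff_chain_at[OF coord_has_derivative[OF c z] this]
  have "((\<lambda>w. transition c d (snd c (\<phi> w))) has_derivative (\<lambda>k. D (k *s curve_deriv c \<phi> z))) (at z)"
    by (simp add: o_def)
  then have "((\<lambda>w. snd d (\<phi> w)) has_derivative (\<lambda>k. D (k *s curve_deriv c \<phi> z))) (at z)"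
    by (rule has_derivative_transform_within_open[OF _ open_chart_preimage[OF c]])
       (use z chart_inv_coord[OF chart[OF c]] in \<open>auto simp: transition_def\<close>)
  from has_derivative_unique[OF this coord_has_derivative[OF d]]
  have "D (1 *s curve_deriv c \<phi> z) = 1 *s curve_deriv d \<phi> z"
    by metis
  then have D: "curve_deriv d \<phi> z = D (curve_deriv c \<phi> z)"
    by simp
  have pos: "v \<noteq> 0 \<Longrightarrow> Re (sesq_form (h d (\<phi> z)) v v) > 0" for v
    using metric d unfolding hermitian_metric_def by blast
  have "Re (sesq_form (h d (\<phi> z)) v v) \<ge> 0" for v
    by (cases "v = 0") (use pos[of v] in \<open>auto simp: sesq_form_def\<close>)
  then have "(speed A h \<phi> z)\<^sup>2 = Re (sesq_form (h d (\<phi> z)) (curve_deriv d \<phi> z) (curve_deriv d \<phi> z))"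
    by (simp add: speed_def d_def[symmetric] Let_def)
  moreover have "sesq_form (h c (\<phi> z)) v w = sesq_form (h d (\<phi> z)) (D v) (D w)" for v w
    unfolding D_def using z d(2)
    by (intro metric[unfolded hermitian_metric_def Let_def, THEN conjunct2, THEN conjunct2,
          rule_format, OF c d(1)]) simp
  ultimately show ?thesis
    by (simp add: D)
qed

lemma speed_nonneg: "0 \<le> speed A h \<phi> z"
proof -
  have pos: "v \<noteq> 0 \<Longrightarrow> Re (sesq_form (h (chart_at A (\<phi> z)) (\<phi> z)) v v) > 0" for v
    using metric chart_at unfolding hermitian_metric_def by blast
  have "Re (sesq_form (h (chart_at A (\<phi> z)) (\<phi> z)) v v) \<ge> 0" for v
    by (cases "v = 0") (use pos[of v] in \<open>auto simp: sesq_form_def\<close>)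
  then show ?thesis by (simp add: speed_def Let_def)
qed

lemma continuous_metric:
  assumes "c \<in> A"
  shows "continuous_on (snd c ` fst c) (\<lambda>x. h c (chart_inv c x) $ i $ j)"
proof -
  have "Ck_on 0 (\<lambda>x. h c (chart_inv c x) $ i $ j) (snd c ` fst c)"
    using metric assms unfolding hermitian_metric_def smooth_on_def by blast
  then show ?thesis by simp
qed

text \<open>The chart chosen by \<open>chart_at\<close> may jump from point to point. By
  \<open>speed_sq\<close> a fixed chart computes the speed on a whole neighbourhood, and there the
  formula is continuous.\<close>

lemma continuous_speed: "continuous_on UNIV (speed A h \<phi>)"
proof (rule continuous_at_imp_continuous_on, rule ballI)
  fix z
  obtain c where c: "c \<in> A" "\<phi> z \<in> fst c"
    using chart_exists curve_in_space by blast
  let ?U = "{z. \<phi> z \<in> fst c}"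
  have hc0: "continuous_on ?U (\<lambda>z. h c (chart_inv c (snd c (\<phi> z))) $ i $ j)" for i j
    by (rule continuous_on_compose2[OF continuous_metric coord_continuous]) (use c in auto)
  have hc: "continuous_on ?U (\<lambda>z. h c (\<phi> z) $ i $ j)" for i j
    by (rule continuous_on_eq[OF hc0[of i j]]) (simp add: chart_inv_coord[OF chart[OF c(1)]])
  have dc: "continuous_on ?U (\<lambda>z. curve_deriv c \<phi> z $ i)" for i
    unfolding curve_deriv_def
    using holomorphic_deriv[OF coord_holomorphic[OF c(1)] open_chart_preimage[OF c(1)]]
    by (simp add: holomorphic_on_imp_continuous_on)
  have "continuous_on ?U (\<lambda>z. sqrt (Re (sesq_form (h c (\<phi> z)) (curve_deriv c \<phi> z) (curve_deriv c \<phi> z))))"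
    unfolding sesq_form_def by (intro continuous_intros hc dc)
  then have "continuous_on ?U (speed A h \<phi>)"
    by (rule continuous_on_eq) (simp add: speed_sq[OF c(1), symmetric] speed_nonneg)
  then show "isCont (speed A h \<phi>) z"
    using continuous_on_eq_continuous_at[OF open_chart_preimage[OF c(1)]] c(2) by auto
qed

text \<open>On the compact product of a coordinate ball and the unit sphere the metric has a
  positive minimum and a finite maximum; homogeneity extends the comparison to all
  velocities.\<close>

lemma local_metric_bounds:
  assumes c: "c \<in> A" and p: "p \<in> fst c"
  obtains s C where "0 < s" "0 < C" "cball (snd c p) s \<subseteq> snd c ` fst c"
    "\<And>z. \<phi> z \<in> fst c \<Longrightarrow> snd c (\<phi> z) \<in> cball (snd c p) s \<Longrightarrow>
       norm (curve_deriv c \<phi> z) \<le> C * speed A h \<phi> z \<and> speed A h \<phi> z \<le> C * norm (curve_deriv c \<phi> z)"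
proof -
  obtain s where s: "0 < s" "cball (snd c p) s \<subseteq> snd c ` fst c"
    using is_chartD(2)[OF chart[OF c]] p open_contains_cball by blast
  let ?B = "cball (snd c p) s" and ?S = "sphere (0 :: complex^'n) 1"
  define Q where "Q = (\<lambda>(x, v). Re (sesq_form (h c (chart_inv c x)) v v))"
  have contQ: "continuous_on (?B \<times> ?S) Q"
    unfolding Q_def case_prod_beta sesq_form_def
    by (intro continuous_intros continuous_on_compose2[OF continuous_metric[OF c]])
       (use s in auto)
  \<comment> \<open>Index types are nonempty, so the unit sphere contains a coordinate vector and
    the extrema exist.\<close>
  have S_ne: "axis undefined 1 \<in> ?S"
    by (simp add: norm_axis_1)
  then have ne: "?B \<times> ?S \<noteq> {}"
    using s(1) by (metis SigmaI centre_in_cball empty_iff less_eq_real_def)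
  have cpt: "compact (?B \<times> ?S)"
    by (intro compact_Times) auto
  obtain xm where xm: "xm \<in> ?B \<times> ?S" "\<And>y. y \<in> ?B \<times> ?S \<Longrightarrow> Q xm \<le> Q y"
    using continuous_attains_inf[OF cpt ne contQ] by blast
  obtain xM where xM: "xM \<in> ?B \<times> ?S" "\<And>y. y \<in> ?B \<times> ?S \<Longrightarrow> Q y \<le> Q xM"
    using continuous_attains_sup[OF cpt ne contQ] by blast
  have Qpos: "Q y > 0" if y: "y \<in> ?B \<times> ?S" for y
  proof -
    obtain x v where xv: "y = (x, v)" "x \<in> ?B" "v \<in> ?S" using y by auto
    then obtain q where q: "q \<in> fst c" "x = snd c q" using s by blast
    have "v \<noteq> 0" using xv by auto
    then show ?thesis
      using metric[unfolded hermitian_metric_def, THEN conjunct1, rule_format, OF c q(1)]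
        chart_inv_coord[OF chart[OF c] q(1)] unfolding Q_def
      by (simp add: xv q(2))
  qed
  \<comment> \<open>A single constant for both directions: \<open>1 / sqrt (Q xm)\<close> bounds the
    coordinate velocity by the speed, \<open>sqrt (Q xM)\<close> the speed by the coordinate
    velocity.\<close>
  define C where "C = max (1 / sqrt (Q xm)) (sqrt (Q xM))"
  have C: "0 < C" "1 / sqrt (Q xm) \<le> C" "sqrt (Q xM) \<le> C"
    using Qpos[OF xm(1)] by (auto simp: C_def less_max_iff_disj)
  show thesis
  proof (rule that[OF s(1) C(1) s(2)])
    fix z assume z: "\<phi> z \<in> fst c" "snd c (\<phi> z) \<in> ?B"
    let ?v = "curve_deriv c \<phi> z"
    have sp: "(speed A h \<phi> z)\<^sup>2 = Re (sesq_form (h c (\<phi> z)) ?v ?v)"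
      by (rule speed_sq[OF c z(1)])
    show "norm ?v \<le> C * speed A h \<phi> z \<and> speed A h \<phi> z \<le> C * norm ?v"
    proof (cases "?v = 0")
      case True
      then have "speed A h \<phi> z = 0" using sp by (simp add: sesq_form_def)
      with True show ?thesis by simp
    next
      case False
      define u where "u = (1 / norm ?v) *\<^sub>R ?v"
      have u: "u \<in> ?S" "?v = norm ?v *\<^sub>R u"
        using False by (auto simp: u_def)
      have "(speed A h \<phi> z)\<^sup>2 = (norm ?v)\<^sup>2 * Q (snd c (\<phi> z), u)"
        unfolding sp Q_def by (subst u(2), subst (2) u(2))
          (simp add: sesq_form_scaleR chart_inv_coord[OF chart[OF c] z(1)])
      then have spQ: "speed A h \<phi> z = norm ?v * sqrt (Q (snd c (\<phi> z), u))"
        using speed_nonneg[of z] by (metis norm_ge_zero real_sqrt_abs real_sqrt_mult abs_of_nonneg)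
      have in_BS: "(snd c (\<phi> z), u) \<in> ?B \<times> ?S"
        using u(1) z(2) by simp
      have lo: "sqrt (Q xm) \<le> sqrt (Q (snd c (\<phi> z), u))" and hi: "sqrt (Q (snd c (\<phi> z), u)) \<le> C"
        using xm(2)[OF in_BS] xM(2)[OF in_BS] C(3) by (auto intro: order_trans[OF real_sqrt_le_mono])
      have "1 \<le> C * sqrt (Q xm)"
        using C(2) Qpos[OF xm(1)] by (simp add: divide_le_eq)
      also have "\<dots> \<le> C * sqrt (Q (snd c (\<phi> z), u))"
        using lo C(1) by simp
      finally have "norm ?v * 1 \<le> norm ?v * (C * sqrt (Q (snd c (\<phi> z), u)))"
        by (intro mult_left_mono) auto
      moreover have "norm ?v * sqrt (Q (snd c (\<phi> z), u)) \<le> norm ?v * C"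
        using hi by (intro mult_left_mono) auto
      ultimately show ?thesis
        unfolding spQ by (simp add: mult_ac)
    qed
  qed
qed

text \<open>A path of small length that starts well inside a coordinate ball cannot leave it: up to the first
  exit time the coordinates move by at most \<open>C * e\<close>, so the exit point is still in a smaller closed ball.\<close>

lemma short_path_stays_in_chart:
  assumes c: "c \<in> A" and C: "0 \<le> C" and sub: "cball x s \<subseteq> snd c ` fst c"
    and bound: "\<And>z. \<phi> z \<in> fst c \<Longrightarrow> snd c (\<phi> z) \<in> cball x s \<Longrightarrow> norm (curve_deriv c \<phi> z) \<le> C * speed A h \<phi> z"
    and \<gamma>: "\<And>t. t \<in> {0..1} \<Longrightarrow> (\<gamma> has_vector_derivative \<gamma>' t) (at t within {0..1})"
    and len: "\<And>t. t \<in> {0..1} \<Longrightarrow> norm (\<gamma>' t) * speed A h \<phi> (\<gamma> t) \<le> e"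
    and start: "\<phi> (\<gamma> 0) \<in> fst c" "norm (snd c (\<phi> (\<gamma> 0)) - x) + C * e < s"
    and t: "t \<in> {0..1}"
  shows "\<phi> (\<gamma> t) \<in> fst c \<and> norm (snd c (\<phi> (\<gamma> t)) - snd c (\<phi> (\<gamma> 0))) \<le> C * e"
proof -
  define N where "N = {q \<in> fst c. snd c q \<in> ball x s}"
  define g where "g t = snd c (\<phi> (\<gamma> t))" for t
  have e: "0 \<le> e"
    using len[of 0] mult_nonneg_nonneg[OF norm_ge_zero[of "\<gamma>' 0"] speed_nonneg[of "\<gamma> 0"]] by simp
  have lip: "norm (g T - g 0) \<le> C * e" if T: "T \<in> {0..1}" and N: "\<And>t. t \<in> {0..T} \<Longrightarrow> \<phi> (\<gamma> t) \<in> N" for T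
  proof -
    have "norm (g T - g 0) \<le> C * e * norm (T - 0)"
    proof (rule differentiable_bound[where S = "{0..T}"])
      fix t assume t: "t \<in> {0..T}"
      then have Nt: "\<phi> (\<gamma> t) \<in> fst c" "snd c (\<phi> (\<gamma> t)) \<in> cball x s"
        using N[OF t] by (auto simp: N_def)
      have "(\<gamma> has_derivative (\<lambda>k. k *\<^sub>R \<gamma>' t)) (at t within {0..T})"
        using \<gamma>[of t] t T unfolding has_vector_derivative_def by (auto intro: has_derivative_subset)
      from has_derivative_compose[OF this coord_has_derivative[OF c Nt(1)]]
      show "(g has_derivative (\<lambda>k. (k *\<^sub>R \<gamma>' t) *s curve_deriv c \<phi> (\<gamma> t))) (at t within {0..T})"
        by (simp add: g_def[abs_def])
      show "onorm (\<lambda>k. (k *\<^sub>R \<gamma>' t) *s curve_deriv c \<phi> (\<gamma> t)) \<le> C * e"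
      proof (rule onorm_le)
        fix k :: real
        have "norm (\<gamma>' t) * norm (curve_deriv c \<phi> (\<gamma> t)) \<le> norm (\<gamma>' t) * (C * speed A h \<phi> (\<gamma> t))"
          using bound[OF Nt] by (rule mult_left_mono) simp
        also have "\<dots> = C * (norm (\<gamma>' t) * speed A h \<phi> (\<gamma> t))"
          by simp
        also have "\<dots> \<le> C * e"
          using len[of t] t T C by (intro mult_left_mono) auto
        finally have "norm k * (norm (\<gamma>' t) * norm (curve_deriv c \<phi> (\<gamma> t))) \<le> norm k * (C * e)"
          by (rule mult_left_mono) simp
        then show "norm ((k *\<^sub>R \<gamma>' t) *s curve_deriv c \<phi> (\<gamma> t)) \<le> C * e * norm k"
          by (simp add: norm_vector_scalar_mult mult_ac)
      qed
    qed (use T in auto)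
    also have "\<dots> \<le> C * e * 1"
      using T C e by (intro mult_left_mono) auto
    finally show ?thesis by simp
  qed
  have cont: "continuous_on {0..1} \<gamma>"
    using \<gamma> by (rule continuous_on_vector_derivative)
  have openN: "open {z. \<phi> z \<in> N}"
    unfolding N_def by (rule open_curve_preimage[OF openin_coord_ball[OF chart[OF c]]])
  have all: "\<forall>t\<in>{0..1}. \<phi> (\<gamma> t) \<in> N"
  proof (rule ccontr)
    define B where "B = {0..1} \<inter> \<gamma> -` (- {z. \<phi> z \<in> N})"
    assume "\<not> (\<forall>t\<in>{0..1}. \<phi> (\<gamma> t) \<in> N)"
    then have ne: "B \<noteq> {}" by (auto simp: B_def)
    have bdd: "bdd_below B" by (auto simp: B_def intro: bdd_belowI)
    have "closed B"
      unfolding B_def by (intro continuous_closed_preimage cont) (auto intro: openN)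
    define \<tau> where "\<tau> = Inf B"
    have \<tau>B: "\<tau> \<in> B"
      unfolding \<tau>_def by (rule closed_contains_Inf[OF ne bdd \<open>closed B\<close>])
    have before: "\<phi> (\<gamma> t) \<in> N" if "t \<in> {0..<\<tau>}" for t
      using cInf_lower[OF _ bdd, of t] that \<tau>B unfolding \<tau>_def[symmetric] by (auto simp: B_def)
    have "norm (snd c (\<phi> (\<gamma> 0)) - x) < s"
      using start(2) C e by (smt (verit) mult_nonneg_nonneg)
    then have "\<phi> (\<gamma> 0) \<in> N"
      using start(1) by (simp add: N_def dist_norm norm_minus_commute)
    then have "\<tau> \<noteq> 0" using \<tau>B by (auto simp: B_def)
    then have \<tau>: "0 < \<tau>" "\<tau> \<le> 1" using \<tau>B by (auto simp: B_def)
    define s' where "s' = norm (g 0 - x) + C * e"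
    have s': "s' < s" using start(2) by (simp add: s'_def g_def)
    define D where "D = {q \<in> fst c. snd c q \<in> cball x s'}"
    \<comment> \<open>Closedness in \<open>X\<close> matters, since it is not yet known that
      \<open>\<gamma> \<tau>\<close> is mapped into the chart domain at all. As
      \<open>s' < s\<close>, the set \<open>D\<close> lies in \<open>N\<close>.\<close>
    have "closedin X D"
      unfolding D_def using manifold s' sub
      by (intro closedin_coord_cball chart[OF c]) (auto simp: complex_manifold_def)
    then have "closed ({0..1} \<inter> \<gamma> -` {z. \<phi> z \<in> D})"
      by (intro continuous_closed_preimage cont closed_curve_preimage) auto
    moreover have "{0..<\<tau>} \<subseteq> {0..1} \<inter> \<gamma> -` {z. \<phi> z \<in> D}"
    proof
      fix t assume t: "t \<in> {0..<\<tau>}"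
      then have "norm (g t - g 0) \<le> C * e"
        using \<tau> before by (intro lip) auto
      then have "norm (g t - x) \<le> s'"
        unfolding s'_def using norm_triangle_ineq[of "g t - g 0" "g 0 - x"] by simp
      then show "t \<in> {0..1} \<inter> \<gamma> -` {z. \<phi> z \<in> D}"
        using before[OF t] t \<tau> by (auto simp: D_def N_def g_def dist_norm norm_minus_commute)
    qed
    ultimately have "closure {0..<\<tau>} \<subseteq> {0..1} \<inter> \<gamma> -` {z. \<phi> z \<in> D}"
      by (rule closure_minimal[rotated])
    moreover have "\<tau> \<in> closure {0..<\<tau>}"
      using \<tau> by simp
    ultimately have "\<phi> (\<gamma> \<tau>) \<in> D"
      by blast
    then have "\<phi> (\<gamma> \<tau>) \<in> N"
      using s' by (auto simp: D_def N_def)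
    then show False using \<tau>B by (auto simp: B_def)
  qed
  then have "norm (g t - g 0) \<le> C * e"
    using t by (intro lip) auto
  with all t show ?thesis by (auto simp: g_def N_def)
qed

text \<open>Where the speed is at most \<open>e\<close>, the segments from \<open>z\<close> within
  the disc have images of length at most \<open>e * r\<close>, so the image of the disc stays in the
  chart. There the area mean value inequality applies to each component of the velocity, and
  \<open>local_metric_bounds\<close> translates between velocity and speed.\<close>

lemma local_mean_value_bound:
  assumes p: "p \<in> topspace X"
  shows "\<exists>U \<delta> C. openin X U \<and> p \<in> U \<and> 0 < \<delta> \<and> 0 < C \<and>
    (\<forall>z r e. \<phi> z \<in> U \<longrightarrow> 0 < r \<longrightarrow> (\<forall>w\<in>cball z r. speed A h \<phi> w \<le> e) \<longrightarrow> e * r < \<delta> \<longrightarrow>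
       (r * speed A h \<phi> z)\<^sup>2 \<le> C * (LINT w:cball z r|lborel. (speed A h \<phi> w)\<^sup>2))"
proof -
  obtain c where c: "c \<in> A" "p \<in> fst c"
    using chart_exists[OF p] by blast
  obtain s C where sC: "0 < s" "0 < C" "cball (snd c p) s \<subseteq> snd c ` fst c"
    and bd: "\<And>z. \<phi> z \<in> fst c \<Longrightarrow> snd c (\<phi> z) \<in> cball (snd c p) s \<Longrightarrow>
       norm (curve_deriv c \<phi> z) \<le> C * speed A h \<phi> z \<and> speed A h \<phi> z \<le> C * norm (curve_deriv c \<phi> z)"
    using local_metric_bounds[OF c] by metis
  define U where "U = {q \<in> fst c. snd c q \<in> ball (snd c p) (s / 2)}"
  \<comment> \<open>One factor \<open>C\<^sup>2\<close> for passing from the speed at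
    \<open>z\<close> to coordinates, another for passing back under the integral, the dimension from
    summing over the components, and \<open>pi\<close> from the area of the disc.\<close>
  define C' where "C' = real CARD('n) * C ^ 4 / pi"
  have "(r * speed A h \<phi> z)\<^sup>2 \<le> C' * (LINT w:cball z r|lborel. (speed A h \<phi> w)\<^sup>2)"
    if z: "\<phi> z \<in> U" and r: "0 < r" and sp: "\<forall>w\<in>cball z r. speed A h \<phi> w \<le> e" and er: "e * r < s / (2 * C)" for z r e
  proof -
    have e: "0 \<le> e"
      using sp r speed_nonneg[of z] by (metis centre_in_cball less_eq_real_def order_trans)
    \<comment> \<open>With \<open>e * r < s / (2 * C)\<close> the coordinates move by less than
      \<open>s / 2\<close> along the segment from \<open>z\<close> to \<open>w\<close>, and
      \<open>U\<close> has radius \<open>s / 2\<close>.\<close>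
    have near: "\<phi> w \<in> fst c \<and> snd c (\<phi> w) \<in> cball (snd c p) s" if w: "w \<in> cball z r" for w
    proof -
      define \<gamma> where "\<gamma> t = z + of_real t * (w - z)" for t
      have wz: "norm (w - z) \<le> r"
        using w by (simp add: dist_norm norm_minus_commute)
      have half: "C * (r * e) < s / 2"
        using er sC(2) by (simp add: field_simps)
      have start: "norm (snd c (\<phi> (\<gamma> 0)) - snd c p) < s / 2"
        using z by (simp add: U_def \<gamma>_def dist_norm norm_minus_commute)
      have *: "\<phi> (\<gamma> 1) \<in> fst c \<and> norm (snd c (\<phi> (\<gamma> 1)) - snd c (\<phi> (\<gamma> 0))) \<le> C * (r * e)"
      proof (rule short_path_stays_in_chart[OF c(1) _ sC(3)])
        show "(\<gamma> has_vector_derivative (w - z)) (at t within {0..1})" for t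
          unfolding \<gamma>_def by (auto intro!: derivative_eq_intros has_vector_derivative_real_field)
        fix t :: real assume "t \<in> {0..1}"
        then have "norm (\<gamma> t - z) \<le> r"
          using wz unfolding \<gamma>_def by (simp add: norm_mult mult_left_le_one_le order_trans[OF mult_left_le_one_le])
        then have "speed A h \<phi> (\<gamma> t) \<le> e"
          using sp by (simp add: dist_norm norm_minus_commute)
        then show "norm (w - z) * speed A h \<phi> (\<gamma> t) \<le> r * e"
          using wz r speed_nonneg by (intro mult_mono) auto
      qed (use bd sC z half start in \<open>auto simp: U_def \<gamma>_def\<close>)
      then have "norm (snd c (\<phi> (\<gamma> 1)) - snd c p) \<le> s"
        using start half norm_triangle_ineq[of "snd c (\<phi> (\<gamma> 1)) - snd c (\<phi> (\<gamma> 0))" "snd c (\<phi> (\<gamma> 0)) - snd c p"]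
        by simp
      with * show ?thesis
        by (simp add: \<gamma>_def dist_norm norm_minus_commute)
    qed
    have cont: "continuous_on (cball z r) (\<lambda>w. (speed A h \<phi> w)\<^sup>2)"
      by (intro continuous_intros continuous_on_subset[OF continuous_speed]) auto
    let ?I = "LINT w:cball z r|lborel. (speed A h \<phi> w)\<^sup>2"
    have comp: "(cmod (curve_deriv c \<phi> z $ i))\<^sup>2 * (pi * r\<^sup>2) \<le> C\<^sup>2 * ?I" for i
    proof -
      have holo: "(\<lambda>w. curve_deriv c \<phi> w $ i) holomorphic_on cball z r"
        unfolding curve_deriv_def vec_lambda_beta
        by (rule holomorphic_on_subset[OF holomorphic_deriv[OF coord_holomorphic[OF c(1)] open_chart_preimage[OF c(1)]]])
           (use near in auto)
      have "(cmod (curve_deriv c \<phi> z $ i))\<^sup>2 * measure lborel (cball z r)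
          \<le> (LINT w:cball z r|lborel. (cmod (curve_deriv c \<phi> w $ i))\<^sup>2)"
        by (rule cmod_square_le_area_integral[OF holo]) (use r in simp)
      also have "\<dots> \<le> (LINT w:cball z r|lborel. C\<^sup>2 * (speed A h \<phi> w)\<^sup>2)"
      proof (rule set_integral_mono)
        show "set_integrable lborel (cball z r) (\<lambda>w. (cmod (curve_deriv c \<phi> w $ i))\<^sup>2)"
          by (intro set_integrable_continuous_compact continuous_intros holomorphic_on_imp_continuous_on[OF holo]) auto
        show "set_integrable lborel (cball z r) (\<lambda>w. C\<^sup>2 * (speed A h \<phi> w)\<^sup>2)"
          by (intro set_integrable_continuous_compact continuous_intros cont) auto
        fix w assume "w \<in> cball z r"
        then have "norm (curve_deriv c \<phi> w) \<le> C * speed A h \<phi> w"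
          using bd near by blast
        then have "cmod (curve_deriv c \<phi> w $ i) \<le> C * speed A h \<phi> w"
          using Finite_Cartesian_Product.norm_nth_le order_trans by blast
        then show "(cmod (curve_deriv c \<phi> w $ i))\<^sup>2 \<le> C\<^sup>2 * (speed A h \<phi> w)\<^sup>2"
          by (metis norm_ge_zero power_mono power_mult_distrib)
      qed
      finally show ?thesis
        using r by (simp add: content_cball unit_ball_vol_2 mult_ac)
    qed
    have "(speed A h \<phi> z)\<^sup>2 \<le> (C * norm (curve_deriv c \<phi> z))\<^sup>2"
      using bd near[of z] r speed_nonneg by (intro power_mono) auto
    also have "\<dots> = C\<^sup>2 * (\<Sum>i\<in>UNIV. (cmod (curve_deriv c \<phi> z $ i))\<^sup>2)"
      by (simp add: power_mult_distrib norm_vec_def L2_set_def sum_nonneg)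
    finally have "(speed A h \<phi> z)\<^sup>2 * (pi * r\<^sup>2) \<le> C\<^sup>2 * (\<Sum>i\<in>UNIV. (cmod (curve_deriv c \<phi> z $ i))\<^sup>2) * (pi * r\<^sup>2)"
      by (rule mult_right_mono) simp
    also have "\<dots> = C\<^sup>2 * (\<Sum>i\<in>UNIV. (cmod (curve_deriv c \<phi> z $ i))\<^sup>2 * (pi * r\<^sup>2))"
      by (simp add: sum_distrib_right mult.assoc)
    also have "\<dots> \<le> C\<^sup>2 * (\<Sum>i\<in>(UNIV :: 'n set). C\<^sup>2 * ?I)"
      by (intro mult_left_mono sum_mono comp) auto
    also have "\<dots> = pi * (C' * ?I)"
      by (simp add: C'_def power4_eq_xxxx power2_eq_square)
    finally have "pi * (r * speed A h \<phi> z)\<^sup>2 \<le> pi * (C' * ?I)"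
      by (simp add: power_mult_distrib mult_ac)
    then show ?thesis by simp
  qed
  moreover have "openin X U"
    unfolding U_def by (rule openin_coord_ball[OF chart[OF c(1)]])
  moreover have "p \<in> U" "0 < s / (2 * C)" "0 < C'"
    unfolding U_def C'_def using c sC by auto
  ultimately show ?thesis by blast
qed

text \<open>Finitely many of the neighbourhoods of \<open>local_mean_value_bound\<close> cover
  \<open>K\<close>; the smallest \<open>\<delta>\<close> and the largest \<open>C\<close> among them
  serve all points of the curve.\<close>

lemma uniform_mean_value_bound:
  assumes K: "compactin X K" "range \<phi> \<subseteq> K"
  obtains \<delta> C where "0 < \<delta>" "0 < C"
    "\<And>z r e. 0 < r \<Longrightarrow> (\<And>w. w \<in> cball z r \<Longrightarrow> speed A h \<phi> w \<le> e) \<Longrightarrow> e * r < \<delta> \<Longrightarrow>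
       (r * speed A h \<phi> z)\<^sup>2 \<le> C * (LINT w:cball z r|lborel. (speed A h \<phi> w)\<^sup>2)"
proof -
  have "\<forall>p\<in>K. \<exists>U \<delta> C. openin X U \<and> p \<in> U \<and> 0 < \<delta> \<and> 0 < C \<and>
    (\<forall>z r e. \<phi> z \<in> U \<longrightarrow> 0 < r \<longrightarrow> (\<forall>w\<in>cball z r. speed A h \<phi> w \<le> e) \<longrightarrow> e * r < \<delta> \<longrightarrow>
       (r * speed A h \<phi> z)\<^sup>2 \<le> C * (LINT w:cball z r|lborel. (speed A h \<phi> w)\<^sup>2))"
    using local_mean_value_bound compactin_subset_topspace[OF K(1)] by blast
  then obtain U \<delta> C where UdC: "\<And>p. p \<in> K \<Longrightarrow> openin X (U p) \<and> p \<in> U p \<and> 0 < \<delta> p \<and> 0 < C p \<and>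
    (\<forall>z r e. \<phi> z \<in> U p \<longrightarrow> 0 < r \<longrightarrow> (\<forall>w\<in>cball z r. speed A h \<phi> w \<le> e) \<longrightarrow> e * r < \<delta> p \<longrightarrow>
       (r * speed A h \<phi> z)\<^sup>2 \<le> C p * (LINT w:cball z r|lborel. (speed A h \<phi> w)\<^sup>2))"
    by metis
  have "\<exists>F. finite F \<and> F \<subseteq> U ` K \<and> K \<subseteq> \<Union>F"
    by (rule compactinD[OF K(1)]) (use UdC in auto)
  then obtain T where T: "finite T" "T \<subseteq> K" "K \<subseteq> \<Union> (U ` T)"
    by (metis finite_subset_image)
  have ne: "T \<noteq> {}" using T(3) K(2) by auto
  define \<delta>0 where "\<delta>0 = Min (\<delta> ` T)"
  define C0 where "C0 = Max (C ` T)"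
  show thesis
  proof (rule that[of \<delta>0 C0])
    show "0 < \<delta>0" unfolding \<delta>0_def using T ne UdC by (subst Min_gr_iff) auto
    show "0 < C0" unfolding C0_def using T ne UdC by (subst Max_gr_iff) (auto simp: subset_iff)
    fix z r e assume zr: "0 < r" "\<And>w. w \<in> cball z r \<Longrightarrow> speed A h \<phi> w \<le> e" "e * r < \<delta>0"
    obtain p where p: "p \<in> T" "\<phi> z \<in> U p" using T(3) K(2) by blast
    let ?I = "LINT w:cball z r|lborel. (speed A h \<phi> w)\<^sup>2"
    have "e * r < \<delta> p"
      using zr(3) T(1) p(1) unfolding \<delta>0_def by (subst (asm) Min_gr_iff) auto
    then have "(r * speed A h \<phi> z)\<^sup>2 \<le> C p * ?I"
      using UdC[of p] p T(2) zr(1,2) by blast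
    also have "\<dots> \<le> C0 * ?I"
      unfolding C0_def using T(1) p(1)
      by (intro mult_right_mono) (auto simp: set_lebesgue_integral_def intro!: integral_nonneg_AE)
    finally show "(r * speed A h \<phi> z)\<^sup>2 \<le> C0 * ?I" .
  qed
qed

section \<open>Decay of the speed at infinity\<close>

lemma speed_sq_set_integrable:
  assumes "bounded S" "S \<in> sets borel"
  shows "set_integrable lborel S (\<lambda>w. (speed A h \<phi> w)\<^sup>2)"
proof -
  obtain r where "S \<subseteq> cball 0 r"
    using assms(1) by (fastforce simp: bounded_iff)
  then show ?thesis
    using assms(2)
    by (intro set_integrable_subset[OF set_integrable_continuous_compact[of "cball 0 r"]] continuous_intros
          continuous_on_subset[OF continuous_speed]) auto
qed

lemma speed_sq_integral_mono:
  assumes "bounded T" "T \<in> sets borel" "S \<in> sets borel" "S \<subseteq> T"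
  shows "(LINT w:S|lborel. (speed A h \<phi> w)\<^sup>2) \<le> (LINT w:T|lborel. (speed A h \<phi> w)\<^sup>2)"
  using speed_sq_set_integrable[OF assms(1,2)] speed_sq_set_integrable[OF bounded_subset[OF assms(1,4)] assms(3)] assms(4)
  unfolding set_lebesgue_integral_def set_integrable_def
  by (intro integral_mono) (auto simp: indicator_def)

text \<open>Point picking: the maximum of \<open>(R - dist z w) * speed w\<close> over the disc bounds the speed by twice its
  value on a smaller disc around the maximum point, where the mean value bound then applies.\<close>

lemma speed_le_of_small_area:
  assumes \<delta>C: "0 < \<delta>" "0 < C"
    and mv: "\<And>z r e. 0 < r \<Longrightarrow> (\<And>w. w \<in> cball z r \<Longrightarrow> speed A h \<phi> w \<le> e) \<Longrightarrow> e * r < \<delta> \<Longrightarrow>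
       (r * speed A h \<phi> z)\<^sup>2 \<le> C * (LINT w:cball z r|lborel. (speed A h \<phi> w)\<^sup>2)"
    and R: "0 < R"
    and small: "C * (LINT w:cball z R|lborel. (speed A h \<phi> w)\<^sup>2) < (\<delta> / 4)\<^sup>2"
  shows "(R * speed A h \<phi> z)\<^sup>2 \<le> 4 * (C * (LINT w:cball z R|lborel. (speed A h \<phi> w)\<^sup>2))"
proof (cases "speed A h \<phi> z = 0")
  case True
  then show ?thesis
    using \<delta>C(2) by (auto simp: set_lebesgue_integral_def intro!: integral_nonneg_AE mult_nonneg_nonneg)
next
  case False
  let ?f = "speed A h \<phi>"
  define a where "a = C * (LINT w:cball z R|lborel. (?f w)\<^sup>2)"
  define M where "M w = (R - dist z w) * ?f w" for w
  have "continuous_on (cball z R) M"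
    unfolding M_def by (intro continuous_intros continuous_on_subset[OF continuous_speed]) auto
  moreover have "cball z R \<noteq> {}" using R by simp
  ultimately obtain z1 where z1: "z1 \<in> cball z R" "\<And>w. w \<in> cball z R \<Longrightarrow> M w \<le> M z1"
    using continuous_attains_sup[OF compact_cball] by blast
  \<comment> \<open>Half the distance from \<open>z1\<close> to the boundary: on the disc of radius
    \<open>\<rho>\<close> around \<open>z1\<close> the weight \<open>R - dist z w\<close> is at
    least half its value at \<open>z1\<close>, so maximality of \<open>M z1\<close> bounds the speed
    by \<open>2 * ?f z1\<close>.\<close>
  define \<rho> where "\<rho> = (R - dist z z1) / 2"
  have Mz1: "M z1 = 2 * \<rho> * ?f z1" by (simp add: M_def \<rho>_def)
  have "0 < R * ?f z"
    using R False speed_nonneg[of z] by simp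
  also have le: "R * ?f z \<le> M z1"
    using z1(2)[of z] R by (simp add: M_def)
  finally have pos: "0 < 2 * \<rho> * ?f z1" unfolding Mz1 .
  moreover have "0 \<le> \<rho>" using z1(1) by (simp add: \<rho>_def)
  ultimately have \<rho>: "0 < \<rho>" and e: "0 < ?f z1"
    using speed_nonneg[of z1] by (auto simp: zero_less_mult_iff)
  have half: "?f w \<le> 2 * ?f z1" if "w \<in> cball z1 \<rho>" for w
  proof -
    have "dist z w \<le> dist z z1 + \<rho>"
      using that dist_triangle[of z w z1] by simp
    moreover have "2 * \<rho> = R - dist z z1" by (simp add: \<rho>_def)
    ultimately have d: "\<rho> \<le> R - dist z w" by linarith
    then have "\<rho> * ?f w \<le> M w"
      unfolding M_def by (intro mult_right_mono speed_nonneg)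
    also have "\<dots> \<le> M z1"
      using d \<rho> by (intro z1(2)) simp
    finally show ?thesis unfolding Mz1 using \<rho> by simp
  qed
  \<comment> \<open>The truncation enforces the proviso of \<open>mv\<close> with
    \<open>e = 2 * ?f z1\<close>, as \<open>2 * ?f z1 * r \<le> \<delta> / 2\<close>.\<close>
  define r where "r = min \<rho> (\<delta> / (4 * ?f z1))"
  have r: "0 < r" "r \<le> \<rho>" using \<rho> e \<delta>C by (auto simp: r_def)
  have "?f z1 * r \<le> ?f z1 * (\<delta> / (4 * ?f z1))"
    using e by (intro mult_left_mono) (auto simp: r_def)
  then have small_r: "2 * ?f z1 * r < \<delta>"
    using e \<delta>C(1) by (simp add: field_simps)
  have "(r * ?f z1)\<^sup>2 \<le> C * (LINT w:cball z1 r|lborel. (?f w)\<^sup>2)"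
    using half r by (intro mv[OF r(1) _ small_r]) auto
  also have "\<dots> \<le> a"
    unfolding a_def
  proof (intro mult_left_mono speed_sq_integral_mono)
    show "cball z1 r \<subseteq> cball z R"
      using r(2) \<rho> by (simp add: cball_subset_cball_iff \<rho>_def dist_commute)
  qed (use \<delta>C in auto)
  finally have key: "(r * ?f z1)\<^sup>2 \<le> a" .
  \<comment> \<open>If the truncation were effective, \<open>r * ?f z1\<close> would equal
    \<open>\<delta> / 4\<close>, which is more than the small area allows.\<close>
  have "r = \<rho>"
  proof (rule ccontr)
    assume "r \<noteq> \<rho>"
    then have "r * ?f z1 = \<delta> / 4"
      using e by (auto simp: r_def min_def field_simps split: if_splits)
    with key have "(\<delta> / 4)\<^sup>2 \<le> a" by (simp only:)
    then show False using small unfolding a_def by linarith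
  qed
  have "(R * ?f z)\<^sup>2 \<le> (2 * (\<rho> * ?f z1))\<^sup>2"
    using le R speed_nonneg[of z] unfolding Mz1 by (intro power_mono) (auto simp: mult.assoc)
  also have "\<dots> \<le> 4 * a"
    using key \<open>r = \<rho>\<close> by (simp add: power_mult_distrib)
  finally show ?thesis by (simp add: a_def)
qed

text \<open>The disc of radius \<open>norm z / 2\<close> around \<open>z\<close> lies in an annulus
  over which the area is \<open>curve_area\<close> at \<open>2 * norm z\<close> minus
  \<open>curve_area\<close> at \<open>norm z / 2\<close>. By convergence this is small, and
  \<open>speed_le_of_small_area\<close> applies.\<close>

lemma norm_mult_speed_tendsto_0:
  assumes K: "compactin X K" "range \<phi> \<subseteq> K"
    and L: "(curve_area A h \<phi> \<longlongrightarrow> L) at_top"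
    and \<epsilon>: "0 < \<epsilon>"
  shows "\<exists>R>0. \<forall>z. R \<le> norm z \<longrightarrow> norm z * speed A h \<phi> z \<le> \<epsilon>"
proof -
  let ?f = "speed A h \<phi>"
  obtain \<delta> C where \<delta>C: "0 < \<delta>" "0 < C"
    and mv: "\<And>z r e. 0 < r \<Longrightarrow> (\<And>w. w \<in> cball z r \<Longrightarrow> ?f w \<le> e) \<Longrightarrow> e * r < \<delta> \<Longrightarrow>
       (r * ?f z)\<^sup>2 \<le> C * (LINT w:cball z r|lborel. (?f w)\<^sup>2)"
    using uniform_mean_value_bound[OF K] by metis
  \<comment> \<open>The first bound meets the smallness condition of
    \<open>speed_le_of_small_area\<close>; the second yields
    \<open>(t / 2 * ?f z)\<^sup>2 \<le> \<epsilon>\<^sup>2 / 4\<close> after the factor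
    \<open>4\<close> there.\<close>
  define \<eta> where "\<eta> = min ((\<delta> / 4)\<^sup>2) (\<epsilon>\<^sup>2 / 16) / C"
  have \<eta>: "0 < \<eta>" using \<delta>C \<epsilon> by (simp add: \<eta>_def)
  obtain R0 where R0: "\<And>t. R0 \<le> t \<Longrightarrow> dist (curve_area A h \<phi> t) L < \<eta> / 2"
    using tendstoD[OF L, of "\<eta> / 2"] \<eta> by (auto simp: eventually_at_top_linorder)
  have "norm z * ?f z \<le> \<epsilon>" if z: "max 1 (2 * R0) \<le> norm z" for z
  proof -
    define t where "t = norm z"
    have t: "1 \<le> t" "R0 \<le> t / 2" using z by (auto simp: t_def)
    let ?D = "ball 0 (2 * t) - ball (0::complex) (t / 2)"
    have ca: "curve_area A h \<phi> s = (LINT w:ball 0 s|lborel. (?f w)\<^sup>2)" for s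
      unfolding curve_area_def by (simp add: ball_def)
    have "ball 0 (2 * t) = ball (0::complex) (t / 2) \<union> ?D"
      using t by auto
    then have "curve_area A h \<phi> (2 * t) = (LINT w:ball 0 (t / 2) \<union> ?D|lborel. (?f w)\<^sup>2)"
      by (simp only: ca)
    also have "\<dots> = curve_area A h \<phi> (t / 2) + (LINT w:?D|lborel. (?f w)\<^sup>2)"
      unfolding ca by (intro set_integral_Un speed_sq_set_integrable) (auto intro: bounded_subset[OF bounded_ball])
    finally have "(LINT w:?D|lborel. (?f w)\<^sup>2) = curve_area A h \<phi> (2 * t) - curve_area A h \<phi> (t / 2)"
      by simp
    also have "\<dots> < \<eta>"
    proof -
      have "R0 \<le> 2 * t" using t by linarith
      from R0[OF this] R0[OF t(2)] show ?thesis
        unfolding dist_real_def by linarith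
    qed
    finally have "(LINT w:?D|lborel. (?f w)\<^sup>2) < \<eta>" .
    moreover have "(LINT w:cball z (t / 2)|lborel. (?f w)\<^sup>2) \<le> (LINT w:?D|lborel. (?f w)\<^sup>2)"
    proof (intro speed_sq_integral_mono)
      show "cball z (t / 2) \<subseteq> ?D"
      proof
        fix w assume "w \<in> cball z (t / 2)"
        then have "norm (z - w) \<le> t / 2" by (simp add: dist_norm)
        then have "norm w \<le> t + t / 2" "t - t / 2 \<le> norm w"
          using norm_triangle_ineq2[of z w] norm_triangle_ineq2[of w z] by (auto simp: t_def norm_minus_commute)
        then show "w \<in> ?D" using t by auto
      qed
    qed (auto intro: bounded_subset[OF bounded_ball])
    ultimately have "C * (LINT w:cball z (t / 2)|lborel. (?f w)\<^sup>2) < C * \<eta>"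
      using \<delta>C by (intro mult_strict_left_mono) auto
    then have lt: "C * (LINT w:cball z (t / 2)|lborel. (?f w)\<^sup>2) < (\<delta> / 4)\<^sup>2"
      "C * (LINT w:cball z (t / 2)|lborel. (?f w)\<^sup>2) < \<epsilon>\<^sup>2 / 16"
      using \<delta>C by (simp_all add: \<eta>_def)
    have "(t / 2 * ?f z)\<^sup>2 \<le> 4 * (C * (LINT w:cball z (t / 2)|lborel. (?f w)\<^sup>2))"
      using t by (intro speed_le_of_small_area[OF \<delta>C mv _ lt(1)]) auto
    moreover have "(t / 2 * ?f z)\<^sup>2 = (t * ?f z)\<^sup>2 / 4"
      by (simp add: power_mult_distrib power_divide)
    ultimately have "(t * ?f z)\<^sup>2 \<le> \<epsilon>\<^sup>2"
      using lt(2) by linarith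
    then show ?thesis
      unfolding t_def by (rule power2_le_imp_le) (use \<epsilon> in simp)
  qed
  then show ?thesis
    by (intro exI[of _ "max 1 (2 * R0)"]) auto
qed

section \<open>The limit at infinity and the extension\<close>

text \<open>The circle through \<open>z\<close>, run through once over \<open>{0..1}\<close>, has
  velocity of norm \<open>2 * pi * norm z\<close>, so \<open>short_path_stays_in_chart\<close>
  applies with the bound \<open>2 * pi * \<epsilon>\<close>.\<close>

lemma circle_stays_in_chart:
  assumes c: "c \<in> A" and C: "0 \<le> C" and sub: "cball x s \<subseteq> snd c ` fst c"
    and bound: "\<And>z. \<phi> z \<in> fst c \<Longrightarrow> snd c (\<phi> z) \<in> cball x s \<Longrightarrow> norm (curve_deriv c \<phi> z) \<le> C * speed A h \<phi> z"
    and slow: "\<And>w. norm w = norm z \<Longrightarrow> norm w * speed A h \<phi> w \<le> \<epsilon>"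
    and z: "z \<noteq> 0" "\<phi> z \<in> fst c" "norm (snd c (\<phi> z) - x) + C * (2 * pi * \<epsilon>) < s"
    and w: "norm w = norm z"
  shows "\<phi> w \<in> fst c \<and> norm (snd c (\<phi> w) - snd c (\<phi> z)) \<le> C * (2 * pi * \<epsilon>)"
proof -
  define \<gamma> where "\<gamma> t = z * exp (of_real (2 * pi * t) * \<i>)" for t :: real
  \<comment> \<open>The angle from \<open>z\<close> to \<open>w\<close> as a fraction of a full
    turn, that is, the parameter at which the path reaches \<open>w\<close>.\<close>
  define a where "a = Arg2pi (w / z) / (2 * pi)"
  have "w / z = exp (\<i> * Arg2pi (w / z))"
    using Arg2pi_eq[of "w / z"] w z(1) by (simp add: norm_divide)
  then have w_eq: "w = \<gamma> a"
    using z(1) by (simp add: \<gamma>_def a_def field_simps)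
  have a: "a \<in> {0..1}"
    using Arg2pi_ge_0[of "w / z"] Arg2pi_lt_2pi[of "w / z"] by (simp add: a_def)
  have norm_\<gamma>: "norm (\<gamma> t) = norm z" for t
    by (simp add: \<gamma>_def norm_mult)
  have "\<phi> (\<gamma> a) \<in> fst c \<and> norm (snd c (\<phi> (\<gamma> a)) - snd c (\<phi> (\<gamma> 0))) \<le> C * (2 * pi * \<epsilon>)"
  proof (rule short_path_stays_in_chart[OF c C sub bound _ _ _ _ a])
    fix t :: real
    have "((\<lambda>y. z * exp (of_real (2 * pi) * y * \<i>)) has_field_derivative
        z * (exp (of_real (2 * pi) * of_real t * \<i>) * (of_real (2 * pi) * \<i>))) (at (of_real t))"
      by (auto intro!: derivative_eq_intros)
    from has_vector_derivative_real_field[OF this]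
    show "(\<gamma> has_vector_derivative (z * (exp (of_real (2 * pi) * of_real t * \<i>) * (of_real (2 * pi) * \<i>)))) (at t within {0..1})"
      by (simp add: \<gamma>_def[abs_def])
    have "norm (z * (exp (of_real (2 * pi) * of_real t * \<i>) * (of_real (2 * pi) * \<i>))) = 2 * pi * norm z"
      using norm_exp_i_times[of "2 * pi * t"] by (simp add: norm_mult mult_ac)
    moreover have "norm z * speed A h \<phi> (\<gamma> t) \<le> \<epsilon>"
      using slow[OF norm_\<gamma>[of t]] norm_\<gamma>[of t] by simp
    ultimately show "norm (z * (exp (of_real (2 * pi) * of_real t * \<i>) * (of_real (2 * pi) * \<i>))) * speed A h \<phi> (\<gamma> t) \<le> 2 * pi * \<epsilon>"
      by (simp add: mult.assoc)
  qed (use z in \<open>auto simp: \<gamma>_def\<close>)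
  then show ?thesis
    unfolding w_eq by (simp add: \<gamma>_def)
qed

text \<open>Otherwise every point of \<open>K\<close> has a neighbourhood that the curve avoids
  outside some disc. Finitely many of these cover \<open>K\<close>, which leaves no place for the
  value at a point outside all of their discs.\<close>

lemma cluster_point_at_infinity:
  assumes K: "compactin X K" "range \<phi> \<subseteq> K"
  obtains p where "p \<in> topspace X" "\<And>U R. openin X U \<Longrightarrow> p \<in> U \<Longrightarrow> \<exists>z. R \<le> norm z \<and> \<phi> z \<in> U"
proof -
  have "\<exists>p\<in>K. \<forall>U R. openin X U \<longrightarrow> p \<in> U \<longrightarrow> (\<exists>z. R \<le> norm z \<and> \<phi> z \<in> U)"
  proof (rule ccontr)
    assume "\<not> ?thesis"
    then obtain U R where UR: "\<And>p. p \<in> K \<Longrightarrow> openin X (U p) \<and> p \<in> U p \<and> (\<forall>z. R p \<le> norm z \<longrightarrow> \<phi> z \<notin> U p)"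
      by metis
    have "\<exists>F. finite F \<and> F \<subseteq> U ` K \<and> K \<subseteq> \<Union>F"
      by (rule compactinD[OF K(1)]) (use UR in auto)
    then obtain T where T: "finite T" "T \<subseteq> K" "K \<subseteq> \<Union> (U ` T)"
      by (metis finite_subset_image)
    define r where "r = (\<Sum>p\<in>T. \<bar>R p\<bar>)"
    have r: "R p \<le> norm (of_real r :: complex)" if "p \<in> T" for p
    proof -
      have "\<bar>R p\<bar> \<le> r"
        unfolding r_def using T(1) that by (intro member_le_sum) auto
      then show ?thesis by simp
    qed
    obtain p where "p \<in> T" "\<phi> (of_real r) \<in> U p"
      using T(3) K(2) by blast
    with UR[of p] r[of p] T(2) show False by blast
  qed
  then show thesis
    using that compactin_subset_topspace[OF K(1)] by blast
qed

text \<open>The circles \<open>norm z = r\<close> have small images, and within a chart the mean value of the coordinates over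
  such a circle does not depend on \<open>r\<close>; so the curve cannot drift away from a cluster point.\<close>

lemma coord_converges_at_infinity:
  assumes K: "compactin X K" "range \<phi> \<subseteq> K"
    and L: "(curve_area A h \<phi> \<longlongrightarrow> L) at_top"
    and cluster: "\<And>U R. openin X U \<Longrightarrow> p \<in> U \<Longrightarrow> \<exists>z. R \<le> norm z \<and> \<phi> z \<in> U"
    and c: "c \<in> A" "p \<in> fst c" and t0: "0 < t0"
  shows "\<exists>R. \<forall>z. R \<le> norm z \<longrightarrow> \<phi> z \<in> fst c \<and> snd c (\<phi> z) \<in> ball (snd c p) t0"
proof -
  let ?x = "snd c p" and ?n = "real CARD('n)"
  obtain s C where sC: "0 < s" "0 < C" "cball ?x s \<subseteq> snd c ` fst c"
    and bd: "\<And>z. \<phi> z \<in> fst c \<Longrightarrow> snd c (\<phi> z) \<in> cball ?x s \<Longrightarrow>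
       norm (curve_deriv c \<phi> z) \<le> C * speed A h \<phi> z \<and> speed A h \<phi> z \<le> C * norm (curve_deriv c \<phi> z)"
    using local_metric_bounds[OF c] by metis
  \<comment> \<open>Half of the radius \<open>s\<close> is kept in reserve for the displacement
    \<open>d\<close> along a circle, so that \<open>circle_stays_in_chart\<close> applies.\<close>
  define t where "t = min t0 (s / 2)"
  have t: "0 < t" "t \<le> t0" "t \<le> s / 2" using t0 sC by (auto simp: t_def)
  \<comment> \<open>Chosen so that \<open>(4 * ?n + 4) * d = t\<close>: an error
    \<open>2 * d\<close> in each of the \<open>?n\<close> coordinates and the initial distance
    \<open>d\<close> together stay below \<open>t / 2\<close>.\<close>
  define d where "d = t / (4 * (?n + 1))"
  have d: "0 < d" using t by (simp add: d_def add_pos_nonneg)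
  have "(4 * ?n + 4) * d = t"
    by (simp add: d_def field_simps add_nonneg_eq_0_iff)
  then have nd: "4 * (?n * d) + 4 * d = t"
    by (simp add: algebra_simps)
  have nd0: "0 \<le> ?n * d" using d by simp
  \<comment> \<open>Circles whose image has length at most \<open>2 * pi * \<epsilon>\<close> then
    move the coordinates by at most \<open>d\<close>.\<close>
  define \<epsilon> where "\<epsilon> = d / (2 * pi * C)"
  have \<epsilon>: "0 < \<epsilon>" "C * (2 * pi * \<epsilon>) = d" using d sC by (auto simp: \<epsilon>_def)
  obtain R0 where R0: "0 < R0" "\<And>z. R0 \<le> norm z \<Longrightarrow> norm z * speed A h \<phi> z \<le> \<epsilon>"
    using norm_mult_speed_tendsto_0[OF K L \<epsilon>(1)] by blast
  define V where "V \<tau> = {q \<in> fst c. snd c q \<in> ball ?x \<tau>}" for \<tau>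
  have openV: "openin X (V \<tau>)" for \<tau>
    unfolding V_def by (rule openin_coord_ball[OF chart[OF c(1)]])
  have circle: "\<phi> w \<in> fst c \<and> norm (snd c (\<phi> w) - snd c (\<phi> z)) \<le> d"
    if "R0 \<le> norm z" "\<phi> z \<in> V t" "norm w = norm z" for z w
  proof -
    have "norm (snd c (\<phi> z) - ?x) < t"
      using that(2) by (simp add: V_def dist_norm norm_minus_commute)
    then have "norm (snd c (\<phi> z) - ?x) + C * (2 * pi * \<epsilon>) < s"
      unfolding \<epsilon>(2) using t nd nd0 d by linarith
    moreover have slow: "norm w * speed A h \<phi> w \<le> \<epsilon>" if "norm w = norm z" for w
      using R0(2)[of w] \<open>R0 \<le> norm z\<close> that by simp
    ultimately have "\<phi> w \<in> fst c \<and> norm (snd c (\<phi> w) - snd c (\<phi> z)) \<le> C * (2 * pi * \<epsilon>)"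
      using that R0(1) sC bd by (intro circle_stays_in_chart[OF c(1) _ sC(3) _ slow]) (auto simp: V_def)
    then show ?thesis unfolding \<epsilon>(2) .
  qed
  obtain z1 where z1: "R0 \<le> norm z1" "\<phi> z1 \<in> V d"
    using cluster[OF openV, of d R0] c d by (auto simp: V_def)
  have "d \<le> t"
    using nd nd0 d by linarith
  then have z1t: "\<phi> z1 \<in> V t"
    using z1(2) by (auto simp: V_def)
  have z1d: "norm (snd c (\<phi> z1) - ?x) < d"
    using z1(2) by (simp add: V_def dist_norm norm_minus_commute)
  define r1 where "r1 = norm z1"
  have r1: "0 < r1" using R0(1) z1(1) unfolding r1_def by linarith
  have first: "\<phi> w \<in> V t" if w: "norm w = r1" for w
  proof -
    have *: "\<phi> w \<in> fst c" "norm (snd c (\<phi> w) - snd c (\<phi> z1)) \<le> d"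
      using circle[OF z1(1) z1t, of w] w by (auto simp: r1_def)
    have "norm (snd c (\<phi> w) - ?x) \<le> d + d"
      by (rule norm_diff_triangle_le[OF *(2) less_imp_le[OF z1d]])
    then have "norm (snd c (\<phi> w) - ?x) < t"
      using nd nd0 d by linarith
    then show ?thesis
      using *(1) by (simp add: V_def dist_norm norm_minus_commute)
  qed
  define E where "E = {z. \<phi> z \<in> V t}"
  have openE: "open E"
    unfolding E_def by (rule open_curve_preimage[OF openV])
  have holo: "(\<lambda>z. snd c (\<phi> z) $ i) holomorphic_on E" for i
    by (rule holomorphic_on_subset[OF coord_holomorphic[OF c(1)]]) (auto simp: E_def V_def)
  have "z \<in> E" if "r1 \<le> norm z" for z
  proof (rule ccontr)
    assume "z \<notin> E"
    \<comment> \<open>The points where the curve has left \<open>V t\<close>. This set is closed, so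
      it has an element \<open>z2\<close> of least norm \<open>r2\<close>; points with norm in
      \<open>[r1, r2)\<close> are still mapped into \<open>V t\<close>.\<close>
    define Q where "Q = {z. r1 \<le> norm z} \<inter> - E"
    have "closed Q"
      unfolding Q_def using openE by (intro closed_Int closed_Collect_le continuous_intros) auto
    moreover have "Q \<noteq> {}" using that \<open>z \<notin> E\<close> by (auto simp: Q_def)
    ultimately obtain z2 where z2: "z2 \<in> Q" "\<And>y. y \<in> Q \<Longrightarrow> dist 0 z2 \<le> dist 0 y"
      using distance_attains_inf by blast
    define r2 where "r2 = norm z2"
    have inE: "w \<in> E" if "r1 \<le> norm w" "norm w < r2" for w
      using z2(2)[of w] that by (force simp: Q_def r2_def)
    have r2: "r1 < r2"
      using first[of z2] z2(1) unfolding Q_def r2_def E_def by force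
    \<comment> \<open>A closed subset of \<open>X\<close> inside \<open>V t\<close>: confining the
      curve to \<open>D\<close> before radius \<open>r2\<close> contradicts, in the limit, the
      choice of \<open>z2\<close>.\<close>
    define D where "D = {q \<in> fst c. snd c q \<in> cball ?x (t / 2)}"
    have inD: "\<phi> w \<in> D" if w: "r1 \<le> norm w" "norm w < r2" for w
    proof -
      have wE: "\<phi> w \<in> V t" using inE[OF w] by (simp add: E_def)
      \<comment> \<open>The circles through \<open>z1\<close> and through \<open>w\<close> have
        oscillation at most \<open>d\<close> around these points, and the annulus between them lies
        in \<open>E\<close>.\<close>
      have "norm (snd c (\<phi> z1) $ i - snd c (\<phi> w) $ i) \<le> 2 * d" for i
      proof (rule circle_oscillation_bound[OF openE holo])
        show "0 < r1" by (rule r1)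
        show "{z. r1 \<le> norm z \<and> norm z \<le> norm w} \<subseteq> E" using inE w by auto
        fix z :: complex
        show "norm (snd c (\<phi> z) $ i - snd c (\<phi> z1) $ i) \<le> d" if "norm z = r1"
          using circle[OF z1(1) z1t, of z] that Finite_Cartesian_Product.norm_nth_le[of "snd c (\<phi> z) - snd c (\<phi> z1)" i]
          by (simp add: r1_def)
        show "norm (snd c (\<phi> z) $ i - snd c (\<phi> w) $ i) \<le> d" if "norm z = norm w"
          using circle[OF _ wE that] w z1(1) Finite_Cartesian_Product.norm_nth_le[of "snd c (\<phi> z) - snd c (\<phi> w)" i]
          by (simp add: r1_def)
      qed (use w in auto)
      then have "norm (snd c (\<phi> z1) - snd c (\<phi> w)) \<le> ?n * (2 * d)"
        by (intro norm_vec_le_card_mult) simp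
      then have "norm (snd c (\<phi> w) - snd c (\<phi> z1)) \<le> ?n * (2 * d)"
        by (simp add: norm_minus_commute)
      from norm_diff_triangle_le[OF this less_imp_le[OF z1d]]
      have "norm (snd c (\<phi> w) - ?x) \<le> 2 * (?n * d) + d"
        by simp
      then have "norm (snd c (\<phi> w) - ?x) \<le> t / 2"
        using nd d by linarith
      then show ?thesis
        using wE by (simp add: D_def V_def dist_norm norm_minus_commute)
    qed
    have "closedin X D"
      unfolding D_def using manifold t sC
      by (intro closedin_coord_cball chart[OF c(1)]) (auto simp: complex_manifold_def)
    then have closedF: "closed {z. \<phi> z \<in> D}"
      by (rule closed_curve_preimage)
    have r2pos: "0 < r2" "0 < r1" using r2 r1 by auto
    \<comment> \<open>Approach \<open>z2\<close> along its ray: the points \<open>a * z2\<close>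
      with \<open>r1 / r2 \<le> a < 1\<close> are mapped into \<open>D\<close>, hence so is
      \<open>z2\<close>.\<close>
    have "closed ((\<lambda>a::real. of_real a * z2) -` {z. \<phi> z \<in> D})"
      by (rule closed_vimage[OF closedF]) (intro continuous_intros)
    moreover have "{r1 / r2..<1} \<subseteq> (\<lambda>a::real. of_real a * z2) -` {z. \<phi> z \<in> D}"
    proof
      fix a assume "a \<in> {r1 / r2..<1}"
      then have a: "r1 / r2 \<le> a" "a < 1" by auto
      have "0 < r1 / r2" using r2pos by simp
      then have "0 \<le> a" using a(1) by linarith
      moreover have "r1 \<le> a * r2"
        using a(1) r2pos(1) by (simp add: pos_divide_le_eq)
      moreover have "a * r2 < r2"
        using a(2) r2pos(1) by simp
      ultimately show "a \<in> (\<lambda>a::real. of_real a * z2) -` {z. \<phi> z \<in> D}"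
        using inD[of "of_real a * z2"] by (simp add: norm_mult r2_def)
    qed
    ultimately have "closure {r1 / r2..<1} \<subseteq> (\<lambda>a::real. of_real a * z2) -` {z. \<phi> z \<in> D}"
      by (rule closure_minimal[rotated])
    moreover have "1 \<in> closure {r1 / r2..<1}"
      using r2 r2pos by simp
    ultimately have "\<phi> (of_real 1 * z2) \<in> D"
      by blast
    then have "\<phi> z2 \<in> V t"
      using t(1) by (auto simp: D_def V_def)
    then show False
      using z2(1) by (simp add: Q_def E_def)
  qed
  then have "\<forall>z. r1 \<le> norm z \<longrightarrow> \<phi> z \<in> fst c \<and> snd c (\<phi> z) \<in> ball ?x t0"
    using t(2) by (fastforce simp: E_def V_def)
  then show ?thesis by blast
qed

lemma limit_at_infinity:
  assumes K: "compactin X K" "range \<phi> \<subseteq> K"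
    and L: "(curve_area A h \<phi> \<longlongrightarrow> L) at_top"
  obtains p where "limitin X \<phi> p at_infinity"
proof -
  obtain p where p: "p \<in> topspace X" "\<And>U R. openin X U \<Longrightarrow> p \<in> U \<Longrightarrow> \<exists>z. R \<le> norm z \<and> \<phi> z \<in> U"
    using cluster_point_at_infinity[OF K] by metis
  obtain c where c: "c \<in> A" "p \<in> fst c"
    using chart_exists[OF p(1)] by blast
  have "limitin X \<phi> p at_infinity"
    unfolding limitin_def
  proof (intro conjI allI impI p(1))
    fix U assume U: "openin X U \<and> p \<in> U"
    \<comment> \<open>Pulls \<open>U\<close> back through the chart, so that it contains a
      coordinate ball around \<open>p\<close>.\<close>
    have "openin (top_of_set (snd c ` fst c)) {y \<in> snd c ` fst c. chart_inv c y \<in> U}"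
      using openin_continuous_map_preimage[OF is_chartD(5)[OF chart[OF c(1)]], of U] U by simp
    then have "open {y \<in> snd c ` fst c. chart_inv c y \<in> U}"
      by (rule openin_open_trans) (rule is_chartD(2)[OF chart[OF c(1)]])
    moreover have "snd c p \<in> {y \<in> snd c ` fst c. chart_inv c y \<in> U}"
      using U c chart_inv_coord[OF chart[OF c(1)]] by auto
    ultimately obtain t where t: "0 < t" "ball (snd c p) t \<subseteq> {y \<in> snd c ` fst c. chart_inv c y \<in> U}"
      using open_contains_ball by blast
    obtain R where R: "\<And>z. R \<le> norm z \<Longrightarrow> \<phi> z \<in> fst c \<and> snd c (\<phi> z) \<in> ball (snd c p) t"
      using coord_converges_at_infinity[OF K L p(2) c t(1)] by blast
    have "\<phi> z \<in> U" if "R \<le> norm z" for z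
      using R[OF that] t(2) chart_inv_coord[OF chart[OF c(1)], of "\<phi> z"] by auto
    then show "\<forall>\<^sub>F z in at_infinity. \<phi> z \<in> U"
      by (auto simp: eventually_at_infinity)
  qed
  then show thesis by (rule that)
qed

section \<open>Extension over the point at infinity\<close>

lemma eventually_in_open:
  assumes "limitin X \<phi> p at_infinity" "openin X U" "p \<in> U"
  obtains R where "0 < R" "\<And>z. R \<le> norm z \<Longrightarrow> \<phi> z \<in> U"
proof -
  have "\<forall>\<^sub>F z in at_infinity. \<phi> z \<in> U"
    using assms by (simp add: limitin_def)
  then obtain R where "\<And>z. R \<le> norm z \<Longrightarrow> \<phi> z \<in> U"
    by (auto simp: eventually_at_infinity)
  then show thesis
    by (intro that[of "max R 1"]) auto
qed

text \<open>Open sets containing \<open>None\<close> are complements of compact sets. If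
  \<open>p \<in> U\<close>, the points not mapped into \<open>U\<close> form a closed set, bounded
  by the existence of the limit.\<close>

lemma continuous_extension:
  assumes lim: "limitin X \<phi> p at_infinity"
  shows "continuous_map P1_topology X (case_option p \<phi>)"
  unfolding continuous_map_def
proof (intro conjI allI impI)
  have "p \<in> topspace X" using lim by (simp add: limitin_def)
  then show "case_option p \<phi> \<in> topspace P1_topology \<rightarrow> topspace X"
    using curve_in_space by (auto split: option.splits)
  fix U assume U: "openin X U"
  have top: "topspace P1_topology = UNIV"
    by (auto simp: P1_topology_def UNIV_option_conv)
  show "openin P1_topology {x \<in> topspace P1_topology. case_option p \<phi> x \<in> U}"
  proof (cases "p \<in> U")
    case True
    obtain R where R: "\<And>z. R \<le> norm z \<Longrightarrow> \<phi> z \<in> U"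
      using eventually_in_open[OF lim U True] by blast
    define C where "C = - {z. \<phi> z \<in> U}"
    have "closed C"
      unfolding C_def using open_curve_preimage[OF U] by (simp add: open_closed)
    moreover have "C \<subseteq> cball 0 R"
      using R by (force simp: C_def)
    ultimately have "compact C"
      using bounded_subset[OF bounded_cball] compact_eq_bounded_closed by blast
    moreover have "{x \<in> topspace P1_topology. case_option p \<phi> x \<in> U} = insert None (Some ` (topspace euclidean - C))"
    proof (rule set_eqI)
      fix x show "x \<in> {x \<in> topspace P1_topology. case_option p \<phi> x \<in> U} \<longleftrightarrow>
          x \<in> insert None (Some ` (topspace euclidean - C))"
        using True unfolding top C_def by (cases x) auto
    qed
    ultimately show ?thesis
      using \<open>closed C\<close> unfolding P1_topology_def openin_Alexandroff_compactification
      by (intro disjI2 exI[of _ C]) simp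
  next
    case False
    then have "{x \<in> topspace P1_topology. case_option p \<phi> x \<in> U} = Some ` {z. \<phi> z \<in> U}"
      unfolding top by (auto split: option.splits simp: image_iff)
    then show ?thesis
      using open_curve_preimage[OF U] by (simp add: P1_topology_def)
  qed
qed

text \<open>Provides the continuity at \<open>w = 0\<close> for the removable singularity argument:
  the curve lies in \<open>U\<close> for \<open>R \<le> norm z\<close>, which covers
  \<open>norm w < 1 / R\<close> for \<open>w = 1 / z\<close>.\<close>

lemma continuous_extension_coord:
  assumes lim: "limitin X \<phi> p at_infinity"
  shows "continuous_map euclidean X (\<lambda>w. case_option p \<phi> (P1_coord_inv w))"
  unfolding continuous_map_def
proof (intro conjI allI impI)
  have "p \<in> topspace X" using lim by (simp add: limitin_def)
  then show "(\<lambda>w. case_option p \<phi> (P1_coord_inv w)) \<in> topspace euclidean \<rightarrow> topspace X"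
    using curve_in_space by (auto split: option.splits)
  fix U assume U: "openin X U"
  let ?W = "{w \<in> - {0}. 1 / w \<in> {z. \<phi> z \<in> U}}"
  have W: "open ?W"
  proof -
    have "continuous_on (- {0}) (\<lambda>w::complex. 1 / w)"
      by (intro continuous_intros) auto
    from continuous_open_preimage[OF this _ open_curve_preimage[OF U]] show ?thesis
      by (auto simp: vimage_def Int_def)
  qed
  have "open {w. case_option p \<phi> (P1_coord_inv w) \<in> U}"
  proof (cases "p \<in> U")
    case True
    obtain R where R: "0 < R" "\<And>z. R \<le> norm z \<Longrightarrow> \<phi> z \<in> U"
      using eventually_in_open[OF lim U True] by blast
    have "\<phi> (1 / w) \<in> U" if "w \<noteq> 0" "norm w < 1 / R" for w
      using that R(1) by (intro R(2)) (simp add: norm_divide field_simps)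
    then have "{w. case_option p \<phi> (P1_coord_inv w) \<in> U} = ?W \<union> ball 0 (1 / R)"
      using True R(1) by (auto simp: P1_coord_inv_def split: if_splits)
    then show ?thesis using W by auto
  next
    case False
    then have "{w. case_option p \<phi> (P1_coord_inv w) \<in> U} = ?W"
      by (auto simp: P1_coord_inv_def split: if_splits)
    then show ?thesis using W by simp
  qed
  then show "openin euclidean {x \<in> topspace euclidean. case_option p \<phi> (P1_coord_inv x) \<in> U}"
    by simp
qed

text \<open>Off \<open>0\<close> this is a coordinate of the curve composed with
  \<open>w \<mapsto> 1 / w\<close>; at \<open>0\<close> continuity makes the isolated singularity
  removable.\<close>

lemma holomorphic_extension_coord:
  assumes lim: "limitin X \<phi> p at_infinity" and d: "d \<in> A"
  defines "S \<equiv> {w. case_option p \<phi> (P1_coord_inv w) \<in> fst d}"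
  shows "open S" "(\<lambda>w. snd d (case_option p \<phi> (P1_coord_inv w)) $ j) holomorphic_on S"
proof -
  let ?g = "\<lambda>w. case_option p \<phi> (P1_coord_inv w)"
  note cg = continuous_extension_coord[OF lim]
  show S: "open S"
    using openin_continuous_map_preimage[OF cg is_chartD(1)[OF chart[OF d]]] by (simp add: S_def)
  have "continuous_map (top_of_set S) (subtopology X (fst d)) ?g"
    using continuous_map_from_subtopology[OF cg] by (auto simp: continuous_map_in_subtopology S_def)
  from continuous_map_compose[OF this is_chartD(4)[OF chart[OF d]]]
  have "continuous_on S (\<lambda>w. snd d (?g w))"
    by (simp add: o_def)
  then have "continuous_on S (\<lambda>w. snd d (?g w) $ j)"
    by (intro continuous_intros)
  moreover have "(\<lambda>w. snd d (?g w) $ j) holomorphic_on S - {0}"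
  proof (rule holomorphic_transform)
    show "(\<lambda>w. snd d (\<phi> (1 / w)) $ j) holomorphic_on S - {0}"
      by (rule holomorphic_on_compose_gen[OF _ coord_holomorphic[OF d], unfolded o_def])
         (auto intro!: holomorphic_intros simp: S_def P1_coord_inv_def)
  qed (auto simp: P1_coord_inv_def)
  ultimately show "(\<lambda>w. snd d (?g w) $ j) holomorphic_on S"
    using S by (rule no_isolated_singularity) simp
qed

lemma holomorphic_extension:
  assumes lim: "limitin X \<phi> p at_infinity"
  shows "holomorphic_map P1_topology P1_atlas X A (case_option p \<phi>)"
  unfolding holomorphic_map_def
proof (intro conjI ballI continuous_extension[OF lim])
  let ?\<psi> = "case_option p \<phi>"
  fix c d assume c: "c \<in> P1_atlas" and d: "d \<in> A"
  let ?f = "\<lambda>q. case q of None \<Rightarrow> 0 | Some z \<Rightarrow> (vec z :: complex^1)"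
  let ?g = "\<lambda>q. case q of None \<Rightarrow> 0 | Some z \<Rightarrow> (vec (1 / z) :: complex^1)"
  consider "c = (range Some, ?f)" | "c = (- {Some 0}, ?g)"
    using c by (auto simp: P1_atlas_def)
  then show "holomorphic_vec_on (snd d \<circ> ?\<psi> \<circ> chart_inv c) (snd c ` {x \<in> fst c. ?\<psi> x \<in> fst d})"
  proof cases
    case 1
    have "snd c ` {x \<in> fst c. ?\<psi> x \<in> fst d} = vec ` {z. \<phi> z \<in> fst d}"
      unfolding 1 by force
    moreover have "snd d \<circ> ?\<psi> \<circ> chart_inv c = (\<lambda>x. snd d (\<phi> (x $ 1)))"
      unfolding 1 chart_inv_P1_finite by (simp add: o_def)
    moreover have "holomorphic_vec_on (\<lambda>x::complex^1. snd d (\<phi> (x $ 1))) (vec ` {z. \<phi> z \<in> fst d})"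
      by (rule holomorphic_vec_on_curve_iff[where F = "\<lambda>z. snd d (\<phi> z)", OF open_chart_preimage[OF d], THEN iffD2])
         (simp add: coord_holomorphic[OF d])
    ultimately show ?thesis by simp
  next
    case 2
    let ?S = "{w. ?\<psi> (P1_coord_inv w) \<in> fst d}"
    have "snd c ` {x \<in> fst c. ?\<psi> x \<in> fst d} = vec ` ?S"
      unfolding 2 using P1_coord_infinity_image[of "{x. ?\<psi> x \<in> fst d}"] by simp
    moreover have "snd d \<circ> ?\<psi> \<circ> chart_inv c = (\<lambda>x. snd d (?\<psi> (P1_coord_inv (x $ 1))))"
      unfolding 2 chart_inv_P1_infinity by (simp add: o_def)
    moreover have "holomorphic_vec_on (\<lambda>x::complex^1. snd d (?\<psi> (P1_coord_inv (x $ 1)))) (vec ` ?S)"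
      by (rule holomorphic_vec_on_curve_iff[where F = "\<lambda>w. snd d (?\<psi> (P1_coord_inv w))",
            OF holomorphic_extension_coord(1)[OF lim d], THEN iffD2])
         (simp add: holomorphic_extension_coord(2)[OF lim d])
    ultimately show ?thesis by simp
  qed
qed

end

text \<open>The compact set containing the image supplies both the uniform constants of the mean
  value bound and the cluster point at infinity. Without it there are counterexamples: the identity
  of the plane with the spherical metric has finite area but no limit in the plane.\<close>

theorem proposition3p31:
  fixes X :: "'a topology"
    and A :: "('a, 'n::finite) chart set"
    and h :: "('a, 'n) chart \<Rightarrow> 'a \<Rightarrow> complex^'n^'n"
    and \<phi> :: "complex \<Rightarrow> 'a"
  assumes "complex_manifold X A"
    and "hermitian_metric A h"
    and "entire_curve X A \<phi>"
    and "\<exists>K. compactin X K \<and> range \<phi> \<subseteq> K"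
    and "\<exists>L. (curve_area A h \<phi> \<longlongrightarrow> L) at_top"
  shows "\<exists>\<phi>'. (\<forall>z. \<phi>' (Some z) = \<phi> z) \<and> holomorphic_map P1_topology P1_atlas X A \<phi>'"
proof -
  interpret hermitian_entire_curve X A h \<phi>
    using assms(1-3) by unfold_locales
  obtain K L where "compactin X K" "range \<phi> \<subseteq> K" "(curve_area A h \<phi> \<longlongrightarrow> L) at_top"
    using assms(4,5) by blast
  then obtain p where "limitin X \<phi> p at_infinity"
    by (rule limit_at_infinity)
  from holomorphic_extension[OF this] show ?thesis
    by (intro exI[of _ "case_option p \<phi>"]) simp
qed

end
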